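(* Let $m\ge2$ be an integer, $w$ an infinite Sturmian or periodic word over $\{0,1\}$, and $A=A(m,w)=A_0\oplus A_1$ with the $\mathbb{Z}_2$-grading in which $z_1^{(1)},a$ are even and $b$ is odd. Let $A^\#$ be obtained from $A$ by adjoining an external unit, with the induced grading. Then $\exp^{gr}(A^\#)$ exists and $\exp^{gr}(A^\#)=1+\exp^{gr}(A)$.
   Context: $F$ is a field of characteristic zero. $A(m,w)$: basis $\{a,b,z_j^{(i)}: i\ge1,1\le j\le m+w_i\}$, products $z_j^{(i)}a=z_{j+1}^{(i)}$ for $j<m+w_i$, $z_{m+w_i}^{(i)}b=z_1^{(i+1)}$, all other products of basis elements zero. The stated grading is $A_0=\mathrm{span}\{a,z_j^{(i)}:i\text{ odd}\}$, $A_1=\mathrm{span}\{b,z_j^{(i)}:i\text{ even}\}$. A word is Sturmian if it has exactly $n+1$ distinct subwords of length $n$ for every $n\ge1$. $A^\#=A\oplus F1$ with $1$ a two-sided unit; its induced grading is $A^\#_0=A_0\oplus F1$, $A^\#_1=A_1$. Graded codimensions: in the free nonassociative algebra $F\{X,Y\}$ with even generators $X$ and odd generators $Y$, graded identities are polynomials vanishing under all degree-respecting substitutions; $c_{k,n-k}(B)=\dim P_{k,n-k}/(P_{k,n-k}\cap Id^{gr}(B))$ with $P_{k,n-k}$ the polynomials multilinear in $x_1..x_k\in X$, $y_1..y_{n-k}\in Y$; $c^{gr}_n(B)=\sum_k\binom nk c_{k,n-k}(B)$; $\exp^{gr}(B)=\lim\sqrt[n]{c_n^{gr}(B)}$ when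 it exists. *)

theory Defs
  imports Complex_Main "HOL-Library.Function_Algebras"
begin

text \<open>Variables: X i are the even generators, Y j the odd generators.\<close>
datatype var = X nat | Y nat

text \<open>Nonassociative monomials = binary trees with variable leaves.\<close>
datatype tree = Leaf var | Node tree tree

fun leaves :: "tree \<Rightarrow> var list" where
  "leaves (Leaf v) = [v]"
| "leaves (Node l r) = leaves l @ leaves r"

definition ml_monomials :: "nat \<Rightarrow> nat \<Rightarrow> tree set" where
  "ml_monomials k l = {t. distinct (leaves t) \<and> set (leaves t) = X ` {1..k} \<union> Y ` {1..l}}"

text \<open>Polynomials of F{X,Y} are finitely supported coefficient functions on monomials.
  The space P_{k,l} of multilinear polynomials.\<close>
definition P_ml :: "nat \<Rightarrow> nat \<Rightarrow> (tree \<Rightarrow> 'f::field) set" where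
  "P_ml k l = {f. \<forall>t. f t \<noteq> 0 \<longrightarrow> t \<in> ml_monomials k l}"

definition fscale :: "'f::field \<Rightarrow> ('a \<Rightarrow> 'f) \<Rightarrow> ('a \<Rightarrow> 'f)" where
  "fscale c f = (\<lambda>x. c * f x)"

lemma vector_space_fscale: "vector_space (fscale :: 'f::field \<Rightarrow> ('a \<Rightarrow> 'f) \<Rightarrow> _)"
  by unfold_locales (auto simp: fscale_def algebra_simps)

text \<open>An algebra is given by a basis set Bs, a multiplication table bmul on basis
  elements (a product of two basis elements is a basis element or 0, encoded by None)
  and a parity predicate ev on basis elements (even basis elements span B_0,
  odd ones span B_1). Elements of the algebra are finitely supported coefficient
  functions on the basis.\<close>

definition supp :: "('b \<Rightarrow> 'f::zero) \<Rightarrow> 'b set" where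
  "supp u = {e. u e \<noteq> 0}"

definition elems :: "'b set \<Rightarrow> ('b \<Rightarrow> bool) \<Rightarrow> ('b \<Rightarrow> 'f::zero) set" where
  "elems Bs P = {u. finite (supp u) \<and> supp u \<subseteq> {e \<in> Bs. P e}}"

definition even_part :: "'b set \<Rightarrow> ('b \<Rightarrow> bool) \<Rightarrow> ('b \<Rightarrow> 'f::zero) set" where
  "even_part Bs ev = elems Bs ev"

definition odd_part :: "'b set \<Rightarrow> ('b \<Rightarrow> bool) \<Rightarrow> ('b \<Rightarrow> 'f::zero) set" where
  "odd_part Bs ev = elems Bs (\<lambda>e. \<not> ev e)"

definition amul :: "('b \<Rightarrow> 'b \<Rightarrow> 'b option) \<Rightarrow> ('b \<Rightarrow> 'f::field) \<Rightarrow> ('b \<Rightarrow> 'f) \<Rightarrow> ('b \<Rightarrow> 'f)" where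
  "amul bmul u v = (\<lambda>e. \<Sum>(p, q) \<in> supp u \<times> supp v.
      if bmul p q = Some e then u p * v q else 0)"

fun eval_tree :: "('b \<Rightarrow> 'b \<Rightarrow> 'b option) \<Rightarrow> (var \<Rightarrow> ('b \<Rightarrow> 'f::field)) \<Rightarrow> tree \<Rightarrow> ('b \<Rightarrow> 'f)" where
  "eval_tree bmul s (Leaf v) = s v"
| "eval_tree bmul s (Node l r) = amul bmul (eval_tree bmul s l) (eval_tree bmul s r)"

definition eval_poly :: "('b \<Rightarrow> 'b \<Rightarrow> 'b option) \<Rightarrow> (var \<Rightarrow> ('b \<Rightarrow> 'f::field)) \<Rightarrow> (tree \<Rightarrow> 'f) \<Rightarrow> ('b \<Rightarrow> 'f)" where
  "eval_poly bmul s f = (\<lambda>e. \<Sum>t \<in> supp f. f t * eval_tree bmul s t e)"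

definition graded_ids :: "'b set \<Rightarrow> ('b \<Rightarrow> 'b \<Rightarrow> 'b option) \<Rightarrow> ('b \<Rightarrow> bool) \<Rightarrow> (tree \<Rightarrow> 'f::field) set" where
  "graded_ids Bs bmul ev = {f. finite (supp f) \<and>
     (\<forall>s. (\<forall>i. s (X i) \<in> even_part Bs ev) \<and> (\<forall>j. s (Y j) \<in> odd_part Bs ev)
          \<longrightarrow> eval_poly bmul s f = (\<lambda>_. 0))}"

text \<open>c_{k,l}(B) = dim P_{k,l} / (P_{k,l} \<inter> Id^gr(B)) = dim P_{k,l} - dim (P_{k,l} \<inter> Id^gr(B))
  (P_{k,l} is finite dimensional).\<close>
definition gr_codim_kl :: "'f::field itself \<Rightarrow> 'b set \<Rightarrow> ('b \<Rightarrow> 'b \<Rightarrow> 'b option) \<Rightarrow> ('b \<Rightarrow> bool) \<Rightarrow> nat \<Rightarrow> nat \<Rightarrow> nat" where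
  "gr_codim_kl _ Bs bmul ev k l =
     vector_space.dim (fscale :: 'f \<Rightarrow> _) (P_ml k l :: (tree \<Rightarrow> 'f) set)
     - vector_space.dim (fscale :: 'f \<Rightarrow> _) (P_ml k l \<inter> (graded_ids Bs bmul ev :: (tree \<Rightarrow> 'f) set))"

definition gr_codim :: "'f::field itself \<Rightarrow> 'b set \<Rightarrow> ('b \<Rightarrow> 'b \<Rightarrow> 'b option) \<Rightarrow> ('b \<Rightarrow> bool) \<Rightarrow> nat \<Rightarrow> nat" where
  "gr_codim F Bs bmul ev n = (\<Sum>k\<le>n. (n choose k) * gr_codim_kl F Bs bmul ev k (n - k))"

definition has_gr_exp :: "'f::field itself \<Rightarrow> 'b set \<Rightarrow> ('b \<Rightarrow> 'b \<Rightarrow> 'b option) \<Rightarrow> ('b \<Rightarrow> bool) \<Rightarrow> real \<Rightarrow> bool" where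
  "has_gr_exp F Bs bmul ev L \<longleftrightarrow> (\<lambda>n. root n (real (gr_codim F Bs bmul ev n))) \<longlonglongrightarrow> L"

text \<open>Infinite words w = w_1 w_2 ... over {0,1}, as functions on positions >= 1
  (the value at 0 is irrelevant).\<close>
definition binary_word :: "(nat \<Rightarrow> nat) \<Rightarrow> bool" where
  "binary_word w \<longleftrightarrow> (\<forall>i\<ge>1. w i \<in> {0, 1})"

definition factors :: "(nat \<Rightarrow> nat) \<Rightarrow> nat \<Rightarrow> nat list set" where
  "factors w n = {map (\<lambda>j. w (i + j)) [0..<n] | i. i \<ge> 1}"

definition sturmian :: "(nat \<Rightarrow> nat) \<Rightarrow> bool" where
  "sturmian w \<longleftrightarrow> (\<forall>n\<ge>1. finite (factors w n) \<and> card (factors w n) = n + 1)"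

definition periodic_word :: "(nat \<Rightarrow> nat) \<Rightarrow> bool" where
  "periodic_word w \<longleftrightarrow> (\<exists>p>0. \<forall>i\<ge>1. w (i + p) = w i)"

text \<open>Basis: a, b, z_j^{(i)} (Z i j).\<close>
datatype abasis = Ba | Bb | Z nat nat

definition A_basis :: "nat \<Rightarrow> (nat \<Rightarrow> nat) \<Rightarrow> abasis set" where
  "A_basis m w = {Ba, Bb} \<union> {Z i j | i j. i \<ge> 1 \<and> 1 \<le> j \<and> j \<le> m + w i}"

fun A_mul :: "nat \<Rightarrow> (nat \<Rightarrow> nat) \<Rightarrow> abasis \<Rightarrow> abasis \<Rightarrow> abasis option" where
  "A_mul m w (Z i j) Ba = (if j < m + w i then Some (Z i (j + 1)) else None)"
| "A_mul m w (Z i j) Bb = (if j = m + w i then Some (Z (i + 1) 1) else None)"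
| "A_mul m w _ _ = None"

fun A_even :: "abasis \<Rightarrow> bool" where
  "A_even Ba = True"
| "A_even Bb = False"
| "A_even (Z i j) = odd i"

text \<open>A^# = A \<oplus> F1: basis None (= 1) and Some e for e a basis element of A.\<close>
definition U_basis :: "'b set \<Rightarrow> 'b option set" where
  "U_basis Bs = insert None (Some ` Bs)"

fun U_mul :: "('b \<Rightarrow> 'b \<Rightarrow> 'b option) \<Rightarrow> 'b option \<Rightarrow> 'b option \<Rightarrow> 'b option option" where
  "U_mul bmul None q = Some q"
| "U_mul bmul (Some p) None = Some (Some p)"
| "U_mul bmul (Some p) (Some q) = map_option Some (bmul p q)"

fun U_even :: "('b \<Rightarrow> bool) \<Rightarrow> 'b option \<Rightarrow> bool" where
  "U_even ev None = True"
| "U_even ev (Some p) = ev p"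

end

(*
  Evaluating a multilinear polynomial on basis elements only needs, for each graded basis
  substitution and each basis element e, the sum of the coefficients of the monomials that take
  the value e. Hence c_{k,l} is the rank of these coefficient sums: it is at most the number of
  distinct nonempty classes of monomials, and at least the size of any identity submatrix.

  In A a monomial survives only if it is left-normed, and then its class is given by its first
  variable and by the parity pattern of the others, which must be a factor of the infinite word
  with blocks a^(m+w_i-1) b. There are polynomially many such factors of length n, and as m >= 2
  at most about half of the letters are b; the maximal number of b's in a factor of length n is
  subadditive in n, so it has a density p <= 1/2, and the exponent of A is
  L = p^(-p) (1-p)^(-(1-p)).

  In A^# a class also records which variables are replaced by 1. This gives
  c_n(A^#) <= sum_j (n choose j) U(n-j) with the upper bound U for A. Conversely, the monomials
  x_1(x_2(...(x_j g))) with g a left-normed monomial are separated by setting the x_i to 1, so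
  c_n(A^#) >= (n choose j) d(n-j) with the lower bound d for A. As U and d grow like L^n, both
  bounds grow like (1 + L)^n.
*)
theory Submission
  imports Defs "HOL-Library.FuncSet"
begin

section \<open>Codimensions as ranks of evaluation classes\<close>

text \<open>Exact codimensions are never computed: only exponential rates are compared, so
  polynomial factors may be lost. With l odd variables among n, c_{n-l,l}(A) vanishes unless l is at
  most one more than the largest number of b's in a pattern of n - 1 letters, and is polynomially
  bounded otherwise. So c_n(A) lies, up to such factors, between one binomial at an extremal l and
  the sum of all binomials up to it. These have the same rate because the density p is at most 1/2,
  the range where binomials increase in l; here blocks of length at least two matter.

  The obstacle in A^# is to separate padded monomials. The padding stands on the left because a z
  absorbs letters only on its right, so a padding variable not set to 1 annihilates every z. It need
  not annihilate a letter, as z times b can survive. Two odd variables inside g exclude this: 1 is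
  even, so an odd variable is never replaced by it. Hence the lower bounds for A^# begin at lengths
  where the extremal pattern forces two odd variables.\<close>

interpretation fs: vector_space "fscale :: 'f::field \<Rightarrow> ('a \<Rightarrow> 'f) \<Rightarrow> _"
  by (rule vector_space_fscale)

section \<open>Dimension counts inside finitely spanned subspaces\<close>

context vector_space
begin

text \<open>If some v in V has \<open>\<phi> v \<noteq> 0\<close>, subtracting a multiple of v moves
  any u into the kernel, so a basis of the kernel together with v spans V. The finite
  \<open>W\<close> guards against the default value of \<open>dim\<close> in infinite dimension,
  since the ambient function space is not finite dimensional.\<close>

lemma dim_kernel_ge:
  assumes V: "subspace V" and fin: "finite W" "V \<subseteq> span W"
    and add: "\<And>u v. \<phi> (u + v) = \<phi> u + (\<phi> v :: 'a)" and scal: "\<And>c u. \<phi> (scale c u) = c * \<phi> u"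
  shows "dim V \<le> dim (V \<inter> {u. \<phi> u = 0}) + 1"
proof -
  obtain B where B: "B \<subseteq> V \<inter> {u. \<phi> u = 0}" "independent B" "V \<inter> {u. \<phi> u = 0} \<subseteq> span B"
    "card B = dim (V \<inter> {u. \<phi> u = 0})"
    by (rule basis_exists)
  have fB: "finite B" using independent_span_bound[OF fin(1) B(2)] B(1) fin(2) by blast
  show ?thesis
  proof (cases "\<exists>v\<in>V. \<phi> v \<noteq> 0")
    case True
    then obtain v where v: "v \<in> V" "\<phi> v \<noteq> 0" by blast
    have "V \<subseteq> span (insert v B)"
    proof
      fix u assume u: "u \<in> V"
      let ?c = "\<phi> u / \<phi> v"
      have "u + scale (- ?c) v \<in> V" using V u v by (intro subspace_add subspace_scale)
      moreover have "\<phi> (u + scale (- ?c) v) = 0" using v add[of u "scale (- ?c) v"] scal[of "- ?c" v] by (simp del: scale_minus_left)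
      ultimately have "u + scale (- ?c) v \<in> span B" using B(3) by auto
      then have "u - scale ?c v \<in> span B" by simp
      then show "u \<in> span (insert v B)" by (auto simp: span_insert)
    qed
    then have "dim V \<le> card (insert v B)" using fB by (intro dim_le_card) auto
    then show ?thesis using B(4) fB by (metis card_insert_le_m1 card_insert_if Suc_eq_plus1 le_SucI)
  next
    case False
    then have "V \<inter> {u. \<phi> u = 0} = V" by auto
    then show ?thesis by simp
  qed
qed

lemma dim_less_subspace:
  assumes V: "subspace V'" "V' \<subseteq> V" and fin: "finite W" "V \<subseteq> span W" and v: "v \<in> V" "v \<notin> V'"
  shows "dim V' + 1 \<le> dim V"
proof -
  obtain B where B: "B \<subseteq> V'" "independent B" "V' \<subseteq> span B" "card B = dim V'"
    by (rule basis_exists)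
  obtain C where C: "C \<subseteq> V" "independent C" "V \<subseteq> span C" "card C = dim V"
    by (rule basis_exists)
  have fC: "finite C" using independent_span_bound[OF fin(1) C(2)] C(1) fin(2) by blast
  have fB: "finite B" using independent_span_bound[OF fin(1) B(2)] B(1) V fin(2) by blast
  have "v \<notin> span B" using B(1) V(1) v(2) span_minimal by blast
  then have "independent (insert v B)" using B(2) by (rule independent_insertI)
  moreover have "v \<notin> B" using \<open>v \<notin> span B\<close> by (meson span_base)
  moreover have "insert v B \<subseteq> span C" using B(1) V v C(3) by auto
  ultimately have "card (insert v B) \<le> card C" using independent_span_bound[OF fC] by blast
  then show ?thesis using B(4) C(4) fB \<open>v \<notin> B\<close> by simp
qed

lemma dim_mono_fin:
  assumes "V' \<subseteq> V" "finite W" "V \<subseteq> span W"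
  shows "dim V' \<le> dim V"
proof -
  obtain C where C: "C \<subseteq> V" "independent C" "V \<subseteq> span C" "card C = dim V"
    by (rule basis_exists)
  have "finite C" using independent_span_bound[OF assms(2) C(2)] C(1) assms(3) by blast
  then show ?thesis using dim_le_card[of V' C] assms(1) C by auto
qed

end

section \<open>Conditions given by sums over sets of monomials\<close>

definition supported :: "'a set \<Rightarrow> ('a \<Rightarrow> 'f::field) set" where
  "supported M = {f. \<forall>t. f t \<noteq> 0 \<longrightarrow> t \<in> M}"

definition delta_fun :: "'a \<Rightarrow> 'a \<Rightarrow> 'f::field" where
  "delta_fun a = (\<lambda>b. if b = a then 1 else 0)"

text \<open>The solution space of a linear system whose matrix is the 0/1 incidence matrix of
  \<open>Q\<close>. For finite \<open>M\<close> and sets in \<open>Q\<close> contained in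
  \<open>M\<close>, its codimension in \<open>supported M\<close> is the rank of that
  matrix.\<close>

definition annih :: "'a set \<Rightarrow> 'a set set \<Rightarrow> ('a \<Rightarrow> 'f::field) set" where
  "annih M Q = supported M \<inter> {f. \<forall>T\<in>Q. sum f T = 0}"

lemma subspace_annih: "fs.subspace (annih M Q)"
  unfolding fs.subspace_def annih_def supported_def fscale_def
  by (auto simp: sum.distrib simp flip: sum_distrib_left) force

lemma sum_apply: "(\<Sum>a\<in>A. F a) x = (\<Sum>a\<in>A. F a x)"
  by (induction A rule: infinite_finite_induct) auto

lemma supported_span:
  assumes "finite M"
  shows "(supported M :: ('a \<Rightarrow> 'f::field) set) \<subseteq> fs.span (delta_fun ` M)"
proof
  fix f :: "'a \<Rightarrow> 'f" assume f: "f \<in> supported M"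
  have "f = (\<Sum>a\<in>M. fscale (f a) (delta_fun a))"
  proof
    fix t
    have "(\<Sum>a\<in>M. fscale (f a) (delta_fun a)) t = (\<Sum>a\<in>M. if a = t then f a else 0)"
      unfolding sum_apply by (rule sum.cong) (auto simp: fscale_def delta_fun_def)
    also have "\<dots> = f t" using f assms by (auto simp: supported_def)
    finally show "f t = (\<Sum>a\<in>M. fscale (f a) (delta_fun a)) t" by simp
  qed
  also have "\<dots> \<in> fs.span (delta_fun ` M)"
    by (intro fs.span_sum fs.span_scale fs.span_base) auto
  finally show "f \<in> fs.span (delta_fun ` M)" .
qed

lemma annih_span:
  assumes "finite M"
  shows "(annih M Q :: ('a \<Rightarrow> 'f::field) set) \<subseteq> fs.span (delta_fun ` M)"
  using supported_span[OF assms] by (auto simp: annih_def)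

lemma dim_annih_ge:
  assumes M: "finite M" and Q: "finite Q"
  shows "fs.dim (supported M :: ('a \<Rightarrow> 'f::field) set) \<le> fs.dim (annih M Q :: ('a \<Rightarrow> 'f) set) + card Q"
  using Q
proof (induction Q)
  case empty
  show ?case by (simp add: annih_def)
next
  case (insert T Q)
  have eq: "annih M (insert T Q) = annih M Q \<inter> {f :: 'a \<Rightarrow> 'f. sum f T = 0}"
    by (auto simp: annih_def)
  have "fs.dim (annih M Q :: ('a \<Rightarrow> 'f) set) \<le> fs.dim (annih M Q \<inter> {f :: 'a \<Rightarrow> 'f. sum f T = 0}) + 1"
    using M by (intro fs.dim_kernel_ge[OF subspace_annih, of "delta_fun ` M"] annih_span)
      (auto simp: fscale_def sum.distrib sum_distrib_left)
  with insert eq show ?case by simp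
qed

text \<open>The incidence of the points \<open>t i\<close> with the sets \<open>T j\<close> is an
  identity matrix, so every new condition cuts the space properly: \<open>delta_fun (t j)\<close>
  satisfies all earlier conditions and violates its own.\<close>

lemma dim_annih_le:
  assumes M: "finite M" and J: "finite J" and tM: "\<And>j. j \<in> J \<Longrightarrow> t j \<in> M" and TM: "\<And>j. j \<in> J \<Longrightarrow> T j \<subseteq> M"
    and tT: "\<And>i j. i \<in> J \<Longrightarrow> j \<in> J \<Longrightarrow> t i \<in> T j \<longleftrightarrow> i = j"
  shows "fs.dim (annih M (T ` J) :: ('a \<Rightarrow> 'f::field) set) + card J \<le> fs.dim (supported M :: ('a \<Rightarrow> 'f) set)"
  using J tM TM tT
proof (induction J)
  case empty
  show ?case by (simp add: annih_def)
next
  case (insert j J)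
  have sum_delta_fun: "sum (delta_fun a :: 'a \<Rightarrow> 'f) (T i) = (if a \<in> T i then 1 else 0)" if "i \<in> insert j J" for a i
  proof -
    have "finite (T i)" using M insert.prems(2)[OF that] finite_subset by blast
    then show ?thesis by (simp add: delta_fun_def)
  qed
  have IH: "fs.dim (annih M (T ` J) :: ('a \<Rightarrow> 'f) set) + card J \<le> fs.dim (supported M :: ('a \<Rightarrow> 'f) set)"
    using insert by auto
  have "fs.dim (annih M (T ` insert j J) :: ('a \<Rightarrow> 'f) set) + 1 \<le> fs.dim (annih M (T ` J) :: ('a \<Rightarrow> 'f) set)"
  proof (rule fs.dim_less_subspace[OF subspace_annih _ _ annih_span[OF M]])
    show "annih M (T ` insert j J) \<subseteq> (annih M (T ` J) :: ('a \<Rightarrow> 'f) set)" by (auto simp: annih_def)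
    show "finite (delta_fun ` M :: ('a \<Rightarrow> 'f) set)" using M by simp
    show "(delta_fun (t j) :: 'a \<Rightarrow> 'f) \<in> annih M (T ` J)"
      using insert.prems insert.hyps sum_delta_fun
      by (auto simp: annih_def supported_def) (auto simp: delta_fun_def split: if_splits)
    show "(delta_fun (t j) :: 'a \<Rightarrow> 'f) \<notin> annih M (T ` insert j J)"
      using insert.prems sum_delta_fun by (auto simp: annih_def)
  qed
  with IH insert show ?case by simp
qed

section \<open>Reduction to substitutions of basis elements\<close>

fun basis_eval :: "('b \<Rightarrow> 'b \<Rightarrow> 'b option) \<Rightarrow> (var \<Rightarrow> 'b) \<Rightarrow> tree \<Rightarrow> 'b option" where
  "basis_eval bmul \<sigma> (Leaf v) = Some (\<sigma> v)"
| "basis_eval bmul \<sigma> (Node l r) =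
     Option.bind (basis_eval bmul \<sigma> l) (\<lambda>p. Option.bind (basis_eval bmul \<sigma> r) (bmul p))"

definition graded_subst :: "'b set \<Rightarrow> ('b \<Rightarrow> bool) \<Rightarrow> (var \<Rightarrow> 'b) \<Rightarrow> bool" where
  "graded_subst Bs ev \<sigma> \<longleftrightarrow> (\<forall>i. \<sigma> (X i) \<in> Bs \<and> ev (\<sigma> (X i))) \<and> (\<forall>j. \<sigma> (Y j) \<in> Bs \<and> \<not> ev (\<sigma> (Y j)))"

definition eval_class :: "('b \<Rightarrow> 'b \<Rightarrow> 'b option) \<Rightarrow> nat \<Rightarrow> nat \<Rightarrow> (var \<Rightarrow> 'b) \<Rightarrow> 'b \<Rightarrow> tree set" where
  "eval_class bmul k l \<sigma> e = {t \<in> ml_monomials k l. basis_eval bmul \<sigma> t = Some e}"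

text \<open>The empty class imposes no condition; with it removed, the number of classes drops to 0
  when every monomial vanishes.\<close>

definition eval_classes :: "'b set \<Rightarrow> ('b \<Rightarrow> 'b \<Rightarrow> 'b option) \<Rightarrow> ('b \<Rightarrow> bool) \<Rightarrow> nat \<Rightarrow> nat \<Rightarrow> tree set set" where
  "eval_classes Bs bmul ev k l = {eval_class bmul k l \<sigma> e | \<sigma> e. graded_subst Bs ev \<sigma>} - {{}}"

lemma basis_eval_cong:
  "(\<And>v. v \<in> set (leaves t) \<Longrightarrow> \<sigma> v = \<tau> v) \<Longrightarrow> basis_eval bmul \<sigma> t = basis_eval bmul \<tau> t"
  by (induction t) auto

lemma leaves_nonempty [simp]: "leaves t \<noteq> []"
  by (induction t) auto

lemma finite_trees:
  assumes "finite V"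
  shows "finite {t. length (leaves t) \<le> n \<and> set (leaves t) \<subseteq> V}"
proof (induction n)
  case 0
  show ?case by simp
next
  case (Suc n)
  let ?S = "{t. length (leaves t) \<le> n \<and> set (leaves t) \<subseteq> V}"
  have "{t. length (leaves t) \<le> Suc n \<and> set (leaves t) \<subseteq> V} \<subseteq> Leaf ` V \<union> (\<lambda>(l, r). Node l r) ` (?S \<times> ?S)"
  proof
    fix t assume t: "t \<in> {t. length (leaves t) \<le> Suc n \<and> set (leaves t) \<subseteq> V}"
    show "t \<in> Leaf ` V \<union> (\<lambda>(l, r). Node l r) ` (?S \<times> ?S)"
    proof (cases t)
      case (Leaf v)
      then show ?thesis using t by auto
    next
      case (Node l r)
      have "length (leaves l) \<noteq> 0" "length (leaves r) \<noteq> 0" by simp_all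
      moreover have "length (leaves l) + length (leaves r) \<le> Suc n" using t Node by simp
      ultimately have "length (leaves l) \<le> n" "length (leaves r) \<le> n" by linarith+
      then have "l \<in> ?S" "r \<in> ?S" using t Node by auto
      then show ?thesis using Node by auto
    qed
  qed
  then show ?case by (rule finite_subset) (use Suc assms in auto)
qed

lemma finite_ml: "finite (ml_monomials k l)"
proof -
  let ?V = "X ` {1..k} \<union> Y ` {1..l}"
  have "ml_monomials k l \<subseteq> {t. length (leaves t) \<le> card ?V \<and> set (leaves t) \<subseteq> ?V}"
    by (auto simp: ml_monomials_def distinct_card[symmetric])
  then show ?thesis by (rule finite_subset) (intro finite_trees, auto)
qed

lemma amul_alt:
  assumes "finite A" "finite B" "supp u \<subseteq> A" "supp v \<subseteq> B"
  shows "amul bmul u v e = (\<Sum>p\<in>A. \<Sum>q\<in>B. if bmul p q = Some e then u p * v q else 0)"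
proof -
  have "amul bmul u v e = (\<Sum>(p, q)\<in>A \<times> B. if bmul p q = Some e then u p * v q else 0)"
    unfolding amul_def
    by (rule sum.mono_neutral_left) (use assms in \<open>auto simp: supp_def split: if_splits\<close>)
  then show ?thesis by (simp add: sum.cartesian_product)
qed

text \<open>Bilinearity for elements written as weighted sums of basis elements
  \<open>f \<sigma>\<close>, where different \<sigma> may give the same basis element and
  \<open>None\<close> contributes 0. Keeping the index sets instead of collecting terms lets the
  formula be iterated along a tree.\<close>

lemma amul_expand:
  fixes wl :: "'s \<Rightarrow> 'f::field" and wr :: "'t \<Rightarrow> 'f" and bmul :: "'b \<Rightarrow> 'b \<Rightarrow> 'b option"
  assumes "finite P" "finite Q"
  shows "amul bmul (\<lambda>p. \<Sum>\<sigma>\<in>P. if f \<sigma> = Some p then wl \<sigma> else 0)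
      (\<lambda>q. \<Sum>\<tau>\<in>Q. if g \<tau> = Some q then wr \<tau> else 0) e
    = (\<Sum>\<sigma>\<in>P. \<Sum>\<tau>\<in>Q. if Option.bind (f \<sigma>) (\<lambda>p. Option.bind (g \<tau>) (bmul p)) = Some e
        then wl \<sigma> * wr \<tau> else 0)"
proof -
  let ?A = "{p. \<exists>\<sigma>\<in>P. f \<sigma> = Some p}" and ?B = "{q. \<exists>\<tau>\<in>Q. g \<tau> = Some q}"
  let ?u = "\<lambda>p. \<Sum>\<sigma>\<in>P. if f \<sigma> = Some p then wl \<sigma> else 0"
  let ?v = "\<lambda>q. \<Sum>\<tau>\<in>Q. if g \<tau> = Some q then wr \<tau> else 0"
  have "?A \<subseteq> (\<lambda>\<sigma>. the (f \<sigma>)) ` P" "?B \<subseteq> (\<lambda>\<sigma>. the (g \<sigma>)) ` Q" by force+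
  then have fin: "finite ?A" "finite ?B" using assms by (auto intro: finite_subset)
  have "?u p = 0" if "p \<notin> ?A" for p using that by (intro sum.neutral) auto
  moreover have "?v q = 0" if "q \<notin> ?B" for q using that by (intro sum.neutral) auto
  ultimately have su: "supp ?u \<subseteq> ?A" "supp ?v \<subseteq> ?B" unfolding supp_def by blast+
  have "amul bmul ?u ?v e = (\<Sum>p\<in>?A. \<Sum>q\<in>?B. if bmul p q = Some e then ?u p * ?v q else 0)"
    by (rule amul_alt[OF fin su])
  also have "\<dots> = (\<Sum>p\<in>?A. \<Sum>q\<in>?B. \<Sum>\<sigma>\<in>P. \<Sum>\<tau>\<in>Q.
      if bmul p q = Some e \<and> f \<sigma> = Some p \<and> g \<tau> = Some q then wl \<sigma> * wr \<tau> else 0)"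
  proof (intro sum.cong refl)
    fix p q
    have "?u p * ?v q = (\<Sum>\<sigma>\<in>P. \<Sum>\<tau>\<in>Q. (if f \<sigma> = Some p then wl \<sigma> else 0) * (if g \<tau> = Some q then wr \<tau> else 0))"
      by (rule sum_product)
    also have "\<dots> = (\<Sum>\<sigma>\<in>P. \<Sum>\<tau>\<in>Q. if f \<sigma> = Some p \<and> g \<tau> = Some q then wl \<sigma> * wr \<tau> else 0)"
      by (intro sum.cong refl) auto
    finally show "(if bmul p q = Some e then ?u p * ?v q else 0) = (\<Sum>\<sigma>\<in>P. \<Sum>\<tau>\<in>Q.
      if bmul p q = Some e \<and> f \<sigma> = Some p \<and> g \<tau> = Some q then wl \<sigma> * wr \<tau> else 0)"
      by (cases "bmul p q = Some e") simp_all
  qed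
  also have "\<dots> = (\<Sum>\<sigma>\<in>P. \<Sum>\<tau>\<in>Q. \<Sum>p\<in>?A. \<Sum>q\<in>?B.
      if bmul p q = Some e \<and> f \<sigma> = Some p \<and> g \<tau> = Some q then wl \<sigma> * wr \<tau> else 0)"
  proof -
    have sw: "(\<Sum>p\<in>?A. \<Sum>q\<in>?B. \<Sum>\<sigma>\<in>P. \<Sum>\<tau>\<in>Q. h p q \<sigma> \<tau>)
      = (\<Sum>\<sigma>\<in>P. \<Sum>\<tau>\<in>Q. \<Sum>p\<in>?A. \<Sum>q\<in>?B. h p q \<sigma> \<tau>)" for h :: "'b \<Rightarrow> 'b \<Rightarrow> 's \<Rightarrow> 't \<Rightarrow> 'f"
    proof -
      have "(\<Sum>p\<in>?A. \<Sum>q\<in>?B. \<Sum>\<sigma>\<in>P. \<Sum>\<tau>\<in>Q. h p q \<sigma> \<tau>)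
        = (\<Sum>(p, q)\<in>?A \<times> ?B. \<Sum>\<sigma>\<in>P. \<Sum>\<tau>\<in>Q. h p q \<sigma> \<tau>)"
        by (rule sum.cartesian_product)
      also have "\<dots> = (\<Sum>\<sigma>\<in>P. \<Sum>(p, q)\<in>?A \<times> ?B. \<Sum>\<tau>\<in>Q. h p q \<sigma> \<tau>)"
        unfolding split_def by (rule sum.swap)
      also have "\<dots> = (\<Sum>\<sigma>\<in>P. \<Sum>\<tau>\<in>Q. \<Sum>(p, q)\<in>?A \<times> ?B. h p q \<sigma> \<tau>)"
        unfolding split_def by (intro sum.cong refl sum.swap)
      also have "\<dots> = (\<Sum>\<sigma>\<in>P. \<Sum>\<tau>\<in>Q. \<Sum>p\<in>?A. \<Sum>q\<in>?B. h p q \<sigma> \<tau>)"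
        by (intro sum.cong refl sum.cartesian_product[symmetric])
      finally show ?thesis .
    qed
    show ?thesis by (rule sw)
  qed
  also have "\<dots> = (\<Sum>\<sigma>\<in>P. \<Sum>\<tau>\<in>Q. if Option.bind (f \<sigma>) (\<lambda>p. Option.bind (g \<tau>) (bmul p)) = Some e
        then wl \<sigma> * wr \<tau> else 0)"
  proof (intro sum.cong refl)
    fix \<sigma> \<tau> assume st: "\<sigma> \<in> P" "\<tau> \<in> Q"
    show "(\<Sum>p\<in>?A. \<Sum>q\<in>?B. if bmul p q = Some e \<and> f \<sigma> = Some p \<and> g \<tau> = Some q then wl \<sigma> * wr \<tau> else 0)
      = (if Option.bind (f \<sigma>) (\<lambda>p. Option.bind (g \<tau>) (bmul p)) = Some e then wl \<sigma> * wr \<tau> else 0)"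
    proof (cases "\<exists>p q. f \<sigma> = Some p \<and> g \<tau> = Some q")
      case True
      then obtain p q where pq: "f \<sigma> = Some p" "g \<tau> = Some q" by blast
      have mem: "p \<in> ?A" "q \<in> ?B" using st pq by auto
      have "(\<Sum>p'\<in>?A. \<Sum>q'\<in>?B. if bmul p' q' = Some e \<and> f \<sigma> = Some p' \<and> g \<tau> = Some q' then wl \<sigma> * wr \<tau> else 0)
        = (\<Sum>p'\<in>?A. if p' = p then \<Sum>q'\<in>?B. if q' = q then if bmul p q = Some e then wl \<sigma> * wr \<tau> else 0 else 0 else 0)"
        using pq by (intro sum.cong refl) (auto intro!: sum.cong sum.neutral)
      also have "\<dots> = (if bmul p q = Some e then wl \<sigma> * wr \<tau> else 0)"
        using fin mem by (simp add: sum.delta)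
      finally show ?thesis using pq by simp
    next
      case False
      then have "Option.bind (f \<sigma>) (\<lambda>p. Option.bind (g \<tau>) (bmul p)) \<noteq> Some e"
        by (auto simp: bind_eq_Some_conv)
      then show ?thesis using False by (auto intro!: sum.neutral)
    qed
  qed
  finally show ?thesis .
qed

text \<open>Multilinearity: every variable is expanded over the support of its value. Because the
  leaves are distinct, a choice for the left subtree and one for the right subtree glue uniquely to
  a choice for the whole tree.\<close>

lemma eval_tree_expand:
  fixes s :: "var \<Rightarrow> 'b \<Rightarrow> 'f::field"
  assumes "distinct (leaves t)" "\<And>v. v \<in> set (leaves t) \<Longrightarrow> finite (supp (s v))"
  shows "eval_tree bmul s t = (\<lambda>e. \<Sum>\<sigma>\<in>PiE (set (leaves t)) (\<lambda>v. supp (s v)).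
      if basis_eval bmul \<sigma> t = Some e then \<Prod>v\<in>set (leaves t). s v (\<sigma> v) else 0)"
  using assms
proof (induction t)
  case (Leaf v)
  show ?case
  proof
    fix e
    have "(\<Sum>\<sigma>\<in>PiE {v} (\<lambda>v. supp (s v)). if \<sigma> v = e then s v (\<sigma> v) else 0)
      = (\<Sum>p\<in>supp (s v). if p = e then s v p else 0)"
      by (rule sum.reindex_bij_witness[of _ "\<lambda>p. (\<lambda>u. if u = v then p else undefined)" "\<lambda>\<sigma>. \<sigma> v"])
        (auto simp: PiE_iff extensional_def split: if_splits)
    also have "\<dots> = s v e" using Leaf by (auto simp: supp_def)
    finally show "eval_tree bmul s (Leaf v) e = (\<Sum>\<sigma>\<in>PiE (set (leaves (Leaf v))) (\<lambda>v. supp (s v)).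
      if basis_eval bmul \<sigma> (Leaf v) = Some e then \<Prod>v\<in>set (leaves (Leaf v)). s v (\<sigma> v) else 0)"
      by (simp cong: if_cong)
  qed
next
  case (Node l r)
  let ?L = "set (leaves l)" and ?R = "set (leaves r)" and ?D = "\<lambda>v. supp (s v)"
  have disj: "?L \<inter> ?R = {}" using Node.prems(1) by auto
  have fin: "finite (PiE ?L ?D)" "finite (PiE ?R ?D)" using Node.prems(2) by (auto intro!: finite_PiE)
  have IHl: "eval_tree bmul s l = (\<lambda>p. \<Sum>\<sigma>\<in>PiE ?L ?D. if basis_eval bmul \<sigma> l = Some p then \<Prod>v\<in>?L. s v (\<sigma> v) else 0)"
    using Node by auto
  have IHr: "eval_tree bmul s r = (\<lambda>p. \<Sum>\<sigma>\<in>PiE ?R ?D. if basis_eval bmul \<sigma> r = Some p then \<Prod>v\<in>?R. s v (\<sigma> v) else 0)"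
    using Node by auto
  show ?case
  proof
    fix e
    have "eval_tree bmul s (Node l r) e = (\<Sum>\<sigma>\<in>PiE ?L ?D. \<Sum>\<tau>\<in>PiE ?R ?D.
       if Option.bind (basis_eval bmul \<sigma> l) (\<lambda>p. Option.bind (basis_eval bmul \<tau> r) (bmul p)) = Some e
        then (\<Prod>v\<in>?L. s v (\<sigma> v)) * (\<Prod>v\<in>?R. s v (\<tau> v)) else 0)"
      by (simp only: eval_tree.simps IHl IHr amul_expand[OF fin])
    also have "\<dots> = (\<Sum>(\<sigma>, \<tau>)\<in>PiE ?L ?D \<times> PiE ?R ?D.
       if Option.bind (basis_eval bmul \<sigma> l) (\<lambda>p. Option.bind (basis_eval bmul \<tau> r) (bmul p)) = Some e
        then (\<Prod>v\<in>?L. s v (\<sigma> v)) * (\<Prod>v\<in>?R. s v (\<tau> v)) else 0)"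
      by (rule sum.cartesian_product)
    also have "\<dots> = (\<Sum>\<rho>\<in>PiE (?L \<union> ?R) ?D.
      if basis_eval bmul \<rho> (Node l r) = Some e then \<Prod>v\<in>?L \<union> ?R. s v (\<rho> v) else 0)"
    proof (rule sum.reindex_bij_witness[of _ "\<lambda>\<rho>. (restrict \<rho> ?L, restrict \<rho> ?R)"
          "\<lambda>(\<sigma>, \<tau>). (\<lambda>v. if v \<in> ?L then \<sigma> v else \<tau> v)"], goal_cases)
      case (1 a)
      then show ?case using disj
        by (auto simp: PiE_iff extensional_def restrict_def fun_eq_iff)
    next
      case (2 a)
      then show ?case using disj by (auto simp: PiE_iff extensional_def)
    next
      case (3 b)
      then show ?case by (auto simp: PiE_iff extensional_def restrict_def fun_eq_iff)
    next
      case (4 b)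
      then show ?case by (auto simp: PiE_iff)
    next
      case (5 a)
      obtain \<sigma> \<tau> where a: "a = (\<sigma>, \<tau>)" by fastforce
      let ?\<rho> = "\<lambda>v. if v \<in> ?L then \<sigma> v else \<tau> v"
      have "basis_eval bmul ?\<rho> l = basis_eval bmul \<sigma> l" "basis_eval bmul ?\<rho> r = basis_eval bmul \<tau> r"
        using disj by (auto intro!: basis_eval_cong)
      moreover have "(\<Prod>v\<in>?L \<union> ?R. s v (?\<rho> v)) = (\<Prod>v\<in>?L. s v (\<sigma> v)) * (\<Prod>v\<in>?R. s v (\<tau> v))"
        using disj by (subst prod.union_disjoint) (auto intro!: arg_cong2[of _ _ _ _ "(*)"] prod.cong)
      ultimately show ?case unfolding a by simp
    qed
    finally show "eval_tree bmul s (Node l r) e = (\<Sum>\<sigma>\<in>PiE (set (leaves (Node l r))) (\<lambda>v. supp (s v)).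
      if basis_eval bmul \<sigma> (Node l r) = Some e then \<Prod>v\<in>set (leaves (Node l r)). s v (\<sigma> v) else 0)"
      by (simp cong: if_cong)
  qed
qed

lemma supp_delta_fun [simp]: "supp (delta_fun p :: 'b \<Rightarrow> 'f::field) = {p}"
  by (auto simp: supp_def delta_fun_def)

lemma eval_tree_delta_fun:
  "eval_tree bmul (\<lambda>v. delta_fun (\<sigma> v) :: 'b \<Rightarrow> 'f::field) t
    = (case basis_eval bmul \<sigma> t of None \<Rightarrow> (\<lambda>_. 0) | Some e \<Rightarrow> delta_fun e)"
  by (induction t) (auto simp: amul_def delta_fun_def supp_def fun_eq_iff split: option.splits)

lemma P_ml_supported: "P_ml k l = supported (ml_monomials k l)"
  by (simp add: P_ml_def supported_def)

text \<open>Substituting basis elements into an identity yields exactly the class sums. Conversely,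
  by multilinearity every value of the polynomial is a linear combination of class sums.\<close>

lemma ids_eq_annih:
  fixes Bs :: "'b set"
  assumes ne: "\<exists>\<sigma>. graded_subst Bs ev \<sigma>"
  shows "P_ml k l \<inter> graded_ids Bs bmul ev
    = (annih (ml_monomials k l) (eval_classes Bs bmul ev k l) :: (tree \<Rightarrow> 'f::field) set)"
proof -
  let ?M = "ml_monomials k l" and ?V = "X ` {1..k} \<union> Y ` {1..l}"
  have finM: "finite ?M" by (rule finite_ml)
  have ep: "eval_poly bmul s f e = (\<Sum>t\<in>?M. f t * eval_tree bmul s t e)"
    if "f \<in> supported ?M" for s and f :: "tree \<Rightarrow> 'f" and e
    unfolding eval_poly_def using that finM
    by (intro sum.mono_neutral_left) (auto simp: supp_def supported_def)
  have sum_eval_class: "(\<Sum>t\<in>?M. if basis_eval bmul \<sigma> t = Some e then f t else 0) = sum f (eval_class bmul k l \<sigma> e)"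
    for \<sigma> e and f :: "tree \<Rightarrow> 'f"
    unfolding eval_class_def using finM by (simp add: sum.inter_filter)
  show ?thesis
  proof (rule set_eqI, rule iffI)
    fix f :: "tree \<Rightarrow> 'f" assume f: "f \<in> P_ml k l \<inter> graded_ids Bs bmul ev"
    then have fM: "f \<in> supported ?M" by (simp add: P_ml_supported)
    have "sum f (eval_class bmul k l \<sigma> e) = 0" if g: "graded_subst Bs ev \<sigma>" for \<sigma> e
    proof -
      let ?s = "\<lambda>v. delta_fun (\<sigma> v) :: 'b \<Rightarrow> 'f"
      have "(\<forall>i. ?s (X i) \<in> even_part Bs ev) \<and> (\<forall>j. ?s (Y j) \<in> odd_part Bs ev)"
        using g by (auto simp: even_part_def odd_part_def elems_def graded_subst_def)
      then have "eval_poly bmul ?s f = (\<lambda>_. 0)" using f by (auto simp: graded_ids_def)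
      then have "0 = (\<Sum>t\<in>?M. f t * eval_tree bmul ?s t e)" using ep[OF fM] by metis
      also have "\<dots> = (\<Sum>t\<in>?M. if basis_eval bmul \<sigma> t = Some e then f t else 0)"
        unfolding eval_tree_delta_fun by (intro sum.cong refl) (auto simp: delta_fun_def split: option.splits)
      finally show ?thesis by (simp add: sum_eval_class)
    qed
    then show "f \<in> annih ?M (eval_classes Bs bmul ev k l)" using fM
      by (auto simp: annih_def eval_classes_def)
  next
    fix f :: "tree \<Rightarrow> 'f" assume f: "f \<in> annih ?M (eval_classes Bs bmul ev k l)"
    then have fM: "f \<in> supported ?M" by (simp add: annih_def)
    have z: "sum f (eval_class bmul k l \<sigma> e) = 0" if "graded_subst Bs ev \<sigma>" for \<sigma> e
      using f that by (cases "eval_class bmul k l \<sigma> e = {}") (auto simp: annih_def eval_classes_def)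
    obtain \<sigma>0 where \<sigma>0: "graded_subst Bs ev \<sigma>0" using ne by blast
    have "supp f \<subseteq> ?M" using fM by (auto simp: supp_def supported_def)
    then have "finite (supp f)" using finM finite_subset by blast
    moreover have "eval_poly bmul s f = (\<lambda>_. 0)"
      if s: "(\<forall>i. s (X i) \<in> even_part Bs ev) \<and> (\<forall>j. s (Y j) \<in> odd_part Bs ev)" for s
    proof
      fix e
      have fins: "finite (supp (s v))" for v
        using s by (cases v) (auto simp: even_part_def odd_part_def elems_def)
      let ?P = "PiE ?V (\<lambda>v. supp (s v))"
      have "eval_poly bmul s f e = (\<Sum>t\<in>?M. f t * eval_tree bmul s t e)" by (rule ep[OF fM])
      also have "\<dots> = (\<Sum>t\<in>?M. f t * (\<Sum>\<sigma>\<in>?P.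
          if basis_eval bmul \<sigma> t = Some e then \<Prod>v\<in>?V. s v (\<sigma> v) else 0))"
        by (intro sum.cong refl) (simp add: eval_tree_expand ml_monomials_def fins cong: if_cong)
      also have "\<dots> = (\<Sum>\<sigma>\<in>?P. \<Sum>t\<in>?M.
          if basis_eval bmul \<sigma> t = Some e then f t * (\<Prod>v\<in>?V. s v (\<sigma> v)) else 0)"
        by (subst sum.swap) (auto simp: sum_distrib_left intro!: sum.cong)
      also have "\<dots> = (\<Sum>\<sigma>\<in>?P. (\<Prod>v\<in>?V. s v (\<sigma> v)) * (\<Sum>t\<in>?M.
          if basis_eval bmul \<sigma> t = Some e then f t else 0))"
        by (auto simp: sum_distrib_left intro!: sum.cong)
      also have "\<dots> = 0"
      proof (rule sum.neutral, rule ballI)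
        fix \<sigma> assume \<sigma>: "\<sigma> \<in> ?P"
        \<comment> \<open>The choice \<sigma> is meaningful only on the variables of the monomials;
          \<open>\<sigma>0\<close> completes it to a graded substitution of all variables without
          changing any value.\<close>
        let ?\<tau> = "\<lambda>v. if v \<in> ?V then \<sigma> v else \<sigma>0 v"
        have mem: "\<sigma> v \<in> supp (s v)" if "v \<in> ?V" for v using \<sigma> that by (auto simp: PiE_iff)
        have "\<sigma> (X i) \<in> Bs \<and> ev (\<sigma> (X i))" if "X i \<in> ?V" for i
          using mem[OF that] s unfolding even_part_def elems_def by blast
        moreover have "\<sigma> (Y i) \<in> Bs \<and> \<not> ev (\<sigma> (Y i))" if "Y i \<in> ?V" for i
          using mem[OF that] s unfolding odd_part_def elems_def by blast
        ultimately have "graded_subst Bs ev ?\<tau>"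
          using \<sigma>0 unfolding graded_subst_def by simp
        moreover have "eval_class bmul k l ?\<tau> e = eval_class bmul k l \<sigma> e"
        proof -
          have "basis_eval bmul ?\<tau> t = basis_eval bmul \<sigma> t" if "t \<in> ?M" for t
            by (rule basis_eval_cong) (use that in \<open>auto simp: ml_monomials_def\<close>)
          then show ?thesis by (auto simp: eval_class_def)
        qed
        ultimately have "sum f (eval_class bmul k l \<sigma> e) = 0" using z by metis
        then show "(\<Prod>v\<in>?V. s v (\<sigma> v)) * (\<Sum>t\<in>?M. if basis_eval bmul \<sigma> t = Some e then f t else 0) = 0"
          by (simp add: sum_eval_class)
      qed
      finally show "eval_poly bmul s f e = 0" .
    qed
    ultimately show "f \<in> P_ml k l \<inter> graded_ids Bs bmul ev"
      using fM by (auto simp: graded_ids_def P_ml_supported)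
  qed
qed

lemma finite_eval_classes: "finite (eval_classes Bs bmul ev k l)"
proof -
  have "eval_classes Bs bmul ev k l \<subseteq> Pow (ml_monomials k l)" by (auto simp: eval_classes_def eval_class_def)
  then show ?thesis using finite_ml finite_subset by blast
qed

lemma gr_codim_kl_le:
  assumes "\<exists>\<sigma>. graded_subst Bs ev \<sigma>"
  shows "gr_codim_kl TYPE('f::field) Bs bmul ev k l \<le> card (eval_classes Bs bmul ev k l)"
  unfolding gr_codim_kl_def ids_eq_annih[OF assms] unfolding P_ml_supported
  using dim_annih_ge[OF finite_ml finite_eval_classes, of k l Bs bmul ev k l, where 'f = 'f] by simp

text \<open>The class of \<open>t j\<close> under \<open>\<sigma> j\<close> contains no other
  \<open>t i\<close>, since those vanish there; this is the identity submatrix.\<close>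

lemma gr_codim_kl_ge:
  assumes "finite J" and "\<And>j. j \<in> J \<Longrightarrow> t j \<in> ml_monomials k l"
    and gs: "\<And>j. j \<in> J \<Longrightarrow> graded_subst Bs ev (\<sigma> j)"
    and "\<And>j. j \<in> J \<Longrightarrow> basis_eval bmul (\<sigma> j) (t j) \<noteq> None"
    and "\<And>i j. i \<in> J \<Longrightarrow> j \<in> J \<Longrightarrow> i \<noteq> j \<Longrightarrow> basis_eval bmul (\<sigma> j) (t i) = None"
  shows "card J \<le> gr_codim_kl TYPE('f::field) Bs bmul ev k l"
proof (cases "J = {}")
  case True
  then show ?thesis by simp
next
  case False
  then have ne: "\<exists>\<sigma>. graded_subst Bs ev \<sigma>" using gs by blast
  let ?M = "ml_monomials k l"
  let ?T = "\<lambda>j. eval_class bmul k l (\<sigma> j) (the (basis_eval bmul (\<sigma> j) (t j)))"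
  have tT: "t i \<in> ?T j \<longleftrightarrow> i = j" if "i \<in> J" "j \<in> J" for i j
    using that assms(2,4)[of j] assms(5)[of i j] by (cases "i = j") (auto simp: eval_class_def)
  have 1: "fs.dim (annih ?M (?T ` J) :: (tree \<Rightarrow> 'f) set) + card J \<le> fs.dim (supported ?M :: (tree \<Rightarrow> 'f) set)"
    by (rule dim_annih_le[where t = t]) (use assms tT finite_ml in \<open>auto simp: eval_class_def\<close>)
  have "annih ?M (eval_classes Bs bmul ev k l) \<subseteq> (annih ?M (?T ` J) :: (tree \<Rightarrow> 'f) set)"
    using tT gs by (fastforce simp: annih_def eval_classes_def)
  then have "fs.dim (annih ?M (eval_classes Bs bmul ev k l) :: (tree \<Rightarrow> 'f) set) \<le> fs.dim (annih ?M (?T ` J) :: (tree \<Rightarrow> 'f) set)"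
    by (rule fs.dim_mono_fin[OF _ _ annih_span]) (simp_all add: finite_ml)
  with 1 show ?thesis
    unfolding gr_codim_kl_def ids_eq_annih[OF ne] unfolding P_ml_supported by simp
qed

section \<open>Classes of monomials and upper bounds\<close>

fun even_var :: "var \<Rightarrow> bool" where
  "even_var (X i) = True"
| "even_var (Y j) = False"

text \<open>The pattern of letters along which \<open>z_j^(i)\<close> has a nonzero product: \<open>True\<close> stands for
  \<open>a\<close> and \<open>False\<close> for \<open>b\<close>, matching the parity of the variables.\<close>

fun run :: "nat \<Rightarrow> (nat \<Rightarrow> nat) \<Rightarrow> nat \<Rightarrow> nat \<Rightarrow> nat \<Rightarrow> bool list" where
  "run m w i j 0 = []"
| "run m w i j (Suc n) =
    (if j < m + w i then True # run m w i (j + 1) n else False # run m w (i + 1) 1 n)"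

fun target :: "nat \<Rightarrow> (nat \<Rightarrow> nat) \<Rightarrow> nat \<Rightarrow> nat \<Rightarrow> nat \<Rightarrow> abasis" where
  "target m w i j 0 = Z i j"
| "target m w i j (Suc n) =
    (if j < m + w i then target m w i (j + 1) n else target m w (i + 1) 1 n)"

definition runs :: "nat \<Rightarrow> (nat \<Rightarrow> nat) \<Rightarrow> nat \<Rightarrow> bool list set" where
  "runs m w n = {run m w i j n | i j. 1 \<le> i \<and> 1 \<le> j \<and> j \<le> m + w i}"

abbreviation num_b :: "bool list \<Rightarrow> nat" where
  "num_b q \<equiv> length (filter Not q)"

definition max_b :: "nat \<Rightarrow> (nat \<Rightarrow> nat) \<Rightarrow> nat \<Rightarrow> nat" where
  "max_b m w n = Max (num_b ` runs m w n)"

definition left_normed :: "var \<Rightarrow> var list \<Rightarrow> tree" where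
  "left_normed v vs = foldl (\<lambda>t u. Node t (Leaf u)) (Leaf v) vs"

lemma length_run [simp]: "length (run m w i j n) = n"
  by (induction n arbitrary: i j) auto

lemma finite_runs: "finite (runs m w n)"
proof -
  have "runs m w n \<subseteq> {q. set q \<subseteq> UNIV \<and> length q = n}" by (auto simp: runs_def)
  then show ?thesis by (rule finite_subset) (intro finite_lists_length_eq, simp)
qed

lemma num_b_le_max_b: "q \<in> runs m w n \<Longrightarrow> num_b q \<le> max_b m w n"
  unfolding max_b_def by (rule Max_ge) (auto intro: finite_runs)

lemma leaves_left_normed [simp]: "leaves (left_normed v vs) = v # vs"
proof -
  have "leaves (foldl (\<lambda>t u. Node t (Leaf u)) t vs) = leaves t @ vs" for t
    by (induction vs arbitrary: t) auto
  then show ?thesis by (simp add: left_normed_def)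
qed

lemma basis_eval_foldl_None:
  "basis_eval bmul \<sigma> t = None \<Longrightarrow> basis_eval bmul \<sigma> (foldl (\<lambda>t u. Node t (Leaf u)) t vs) = None"
  by (induction vs arbitrary: t) auto

text \<open>Each z is multiplied to a nonzero element by exactly one of a and b, namely by the first
  letter of its \<open>run\<close>; the other letter kills the product for good.
  \<open>m \<ge> 1\<close> makes 1 a legal position in the next block.\<close>

lemma basis_eval_left_normed:
  assumes "\<And>u. u \<in> set vs \<Longrightarrow> \<sigma> u = (if even_var u then Ba else Bb)" "\<sigma> v = Z i j" "j \<le> m + w i"
    "m \<ge> 1"
  shows "basis_eval (A_mul m w) \<sigma> (left_normed v vs) =
    (if map even_var vs = run m w i j (length vs) then Some (target m w i j (length vs)) else None)"
proof -
  have "basis_eval (A_mul m w) \<sigma> (foldl (\<lambda>t u. Node t (Leaf u)) t vs) =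
    (if map even_var vs = run m w i j (length vs) then Some (target m w i j (length vs)) else None)"
    if "basis_eval (A_mul m w) \<sigma> t = Some (Z i j)" "j \<le> m + w i" for t
    using assms(1) that
  proof (induction vs arbitrary: t i j)
    case Nil
    then show ?case by simp
  next
    case (Cons u vs)
    have u: "\<sigma> u = (if even_var u then Ba else Bb)" using Cons.prems(1) by simp
    have IH: "basis_eval (A_mul m w) \<sigma> (foldl (\<lambda>t u. Node t (Leaf u)) t' vs) =
      (if map even_var vs = run m w i' j' (length vs) then Some (target m w i' j' (length vs)) else None)"
      if "basis_eval (A_mul m w) \<sigma> t' = Some (Z i' j')" "j' \<le> m + w i'" for t' i' j'
      using Cons.IH[OF _ that] Cons.prems(1) by simp
    consider "even_var u" "j < m + w i" | "even_var u" "j = m + w i" | "\<not> even_var u" "j < m + w i" | "\<not> even_var u" "j = m + w i"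
      using Cons.prems(3) by linarith
    then show ?case
    proof cases
      case 1
      then show ?thesis using u Cons.prems(2) IH[of "Node t (Leaf u)" i "j + 1"] by simp
    next
      case 2
      then show ?thesis using u Cons.prems(2) basis_eval_foldl_None[of "A_mul m w" \<sigma> "Node t (Leaf u)" vs] by simp
    next
      case 3
      then show ?thesis using u Cons.prems(2) basis_eval_foldl_None[of "A_mul m w" \<sigma> "Node t (Leaf u)" vs] by simp
    next
      case 4
      then show ?thesis using u Cons.prems(2) IH[of "Node t (Leaf u)" "i + 1" 1] assms(4) by simp
    qed
  qed
  then show ?thesis using assms by (simp add: left_normed_def)
qed

lemma A_mul_Some:
  assumes "A_mul m w p q = Some e"
  obtains i j i' j' where "p = Z i j" "q \<in> {Ba, Bb}" "e = Z i' j'"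
  using assms by (cases "(m, w, p, q)" rule: A_mul.cases) (auto split: if_splits)

text \<open>Nonzero products have z values, while a right factor must be a or b, so a right factor
  is never itself a product. The last conjunct carries this through the induction.\<close>

lemma basis_eval_A_leftnormed:
  assumes "basis_eval (A_mul m w) \<sigma> t = Some e"
  shows "\<exists>v vs. t = left_normed v vs \<and> (vs \<noteq> [] \<longrightarrow> (\<exists>i j. \<sigma> v = Z i j)) \<and> (\<forall>u\<in>set vs. \<sigma> u \<in> {Ba, Bb})
    \<and> (e \<in> {Ba, Bb} \<longrightarrow> vs = [])"
  using assms
proof (induction t arbitrary: e)
  case (Leaf v)
  have "Leaf v = left_normed v []" by (simp add: left_normed_def)
  then show ?case by fastforce
next
  case (Node l r)
  then obtain p q where pq: "basis_eval (A_mul m w) \<sigma> l = Some p" "basis_eval (A_mul m w) \<sigma> r = Some q" "A_mul m w p q = Some e"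
    by (auto simp: bind_eq_Some_conv)
  then obtain i j i' j' where Z: "p = Z i j" "q \<in> {Ba, Bb}" "e = Z i' j'" by (blast elim: A_mul_Some)
  obtain v vs where l: "l = left_normed v vs" "vs \<noteq> [] \<longrightarrow> (\<exists>i j. \<sigma> v = Z i j)" "\<forall>u\<in>set vs. \<sigma> u \<in> {Ba, Bb}"
    using Node.IH(1)[OF pq(1)] by blast
  obtain u where r: "r = left_normed u []" using Node.IH(2)[OF pq(2)] Z(2) by blast
  have "\<sigma> u = q" using pq(2) r by (simp add: left_normed_def)
  have "vs = [] \<Longrightarrow> \<sigma> v = p" using pq(1) l by (simp add: left_normed_def)
  then have "Node l r = left_normed v (vs @ [u])" "\<exists>i j. \<sigma> v = Z i j" "\<forall>u\<in>set (vs @ [u]). \<sigma> u \<in> {Ba, Bb}"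
    using l r Z \<open>\<sigma> u = q\<close> by (auto simp: left_normed_def)
  then show ?case using Z(3) by blast
qed

lemma graded_subst_A_letter:
  assumes "graded_subst (A_basis m w) A_even \<sigma>" "\<sigma> u \<in> {Ba, Bb}"
  shows "\<sigma> u = (if even_var u then Ba else Bb)"
proof (cases u)
  case (X i)
  then have "A_even (\<sigma> u)" using assms(1) by (simp add: graded_subst_def)
  then show ?thesis using assms(2) X by auto
next
  case (Y j)
  then have "\<not> A_even (\<sigma> u)" using assms(1) by (simp add: graded_subst_def)
  then show ?thesis using assms(2) Y by auto
qed

lemma graded_subst_A_basis: "graded_subst (A_basis m w) A_even \<sigma> \<Longrightarrow> \<sigma> u \<in> A_basis m w"
  by (cases u) (auto simp: graded_subst_def)

lemma num_b_map_even_var: "distinct vs \<Longrightarrow> num_b (map even_var vs) = card {u \<in> set vs. \<not> even_var u}"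
  by (simp add: filter_map o_def distinct_card[symmetric])

text \<open>The first variable is the only one with a z value, and the parity of every other
  variable fixes its letter. So the monomials in the class of \<open>t0\<close> are the
  rearrangements with the same first variable and the same pattern. The \<open>+ 1\<close> allows
  for an odd first variable.\<close>

lemma basis_eval_A_class:
  assumes m: "m \<ge> 1" and g: "graded_subst (A_basis m w) A_even \<sigma>"
    and t0: "distinct (leaves t0)" "basis_eval (A_mul m w) \<sigma> t0 = Some e"
  obtains v q where "v \<in> set (leaves t0)" "q \<in> runs m w (length (leaves t0) - 1)"
    "card {u \<in> set (leaves t0). \<not> even_var u} \<le> num_b q + 1"
    "\<forall>t. distinct (leaves t) \<longrightarrow> set (leaves t) = set (leaves t0) \<longrightarrow>
      basis_eval (A_mul m w) \<sigma> t = Some e \<longleftrightarrow> (\<exists>vs. t = left_normed v vs \<and> map even_var vs = q)"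
proof -
  obtain v vs0 where t0eq: "t0 = left_normed v vs0" and Zv: "vs0 \<noteq> [] \<longrightarrow> (\<exists>i j. \<sigma> v = Z i j)"
    and let0: "\<forall>u\<in>set vs0. \<sigma> u \<in> {Ba, Bb}"
    using basis_eval_A_leftnormed[OF t0(2)] by blast
  define q where "q = map even_var vs0"
  have dist: "distinct (v # vs0)" using t0(1) t0eq by simp
  have 1: "v \<in> set (leaves t0)" using t0eq by simp
  have "{u \<in> set (leaves t0). \<not> even_var u} \<subseteq> insert v {u \<in> set vs0. \<not> even_var u}" using t0eq by auto
  then have "card {u \<in> set (leaves t0). \<not> even_var u} \<le> card (insert v {u \<in> set vs0. \<not> even_var u})"
    by (intro card_mono) auto
  also have "\<dots> \<le> num_b q + 1" unfolding q_def using dist by (subst num_b_map_even_var) (auto simp: card_insert_if)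
  finally have 3: "card {u \<in> set (leaves t0). \<not> even_var u} \<le> num_b q + 1" .
  have len: "length (leaves t) = Suc (length vs0)" if "distinct (leaves t)" "set (leaves t) = set (leaves t0)" for t
    using that t0(1) t0eq distinct_card[of "leaves t"] distinct_card[of "leaves t0"] by simp
  show ?thesis
  proof (cases "vs0 = []")
    \<comment> \<open>A single leaf is treated apart because it may carry a letter instead of a
      z.\<close>
    case True
    have "q = run m w 1 1 0" by (simp add: q_def True)
    then have 2: "q \<in> runs m w (length (leaves t0) - 1)"
      unfolding runs_def using m by (auto simp: t0eq True intro!: exI[of _ 1])
    have "basis_eval (A_mul m w) \<sigma> t = Some e \<longleftrightarrow> (\<exists>vs. t = left_normed v vs \<and> map even_var vs = q)"
      if t: "distinct (leaves t)" "set (leaves t) = set (leaves t0)" for t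
    proof -
      have "t = Leaf v"
      proof (cases t)
        case (Leaf u)
        then show ?thesis using t t0eq True by simp
      next
        case (Node l r)
        have "length (leaves l) \<noteq> 0" "length (leaves r) \<noteq> 0" by simp_all
        moreover have "length (leaves l) + length (leaves r) = 1" using len[OF t] Node True by simp
        ultimately show ?thesis by linarith
      qed
      then show ?thesis using t0(2) t0eq True by (auto simp: left_normed_def q_def)
    qed
    then show ?thesis using that 1 2 3 by blast
  next
    case False
    then obtain i j where ij: "\<sigma> v = Z i j" using Zv by blast
    have valid: "1 \<le> i" "1 \<le> j" "j \<le> m + w i" using graded_subst_A_basis[OF g, of v] ij by (auto simp: A_basis_def)
    have let1: "\<sigma> u = (if even_var u then Ba else Bb)" if "u \<in> set vs0" for u
      using graded_subst_A_letter[OF g] let0 that by blast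
    have bl: "basis_eval (A_mul m w) \<sigma> (left_normed v vs) =
      (if map even_var vs = run m w i j (length vs) then Some (target m w i j (length vs)) else None)"
      if "set vs \<subseteq> set vs0" for vs
      using that let1 ij valid m by (intro basis_eval_left_normed) auto
    have q: "q = run m w i j (length vs0)" "e = target m w i j (length vs0)"
      using bl[of vs0] t0(2) t0eq by (auto simp: q_def split: if_splits)
    have 2: "q \<in> runs m w (length (leaves t0) - 1)" unfolding runs_def using q valid t0eq by auto
    have "basis_eval (A_mul m w) \<sigma> t = Some e \<longleftrightarrow> (\<exists>vs. t = left_normed v vs \<and> map even_var vs = q)"
      if t: "distinct (leaves t)" "set (leaves t) = set (leaves t0)" for t
    proof
      assume bt: "basis_eval (A_mul m w) \<sigma> t = Some e"
      then obtain v' vs where t': "t = left_normed v' vs" "vs \<noteq> [] \<longrightarrow> (\<exists>i j. \<sigma> v' = Z i j)"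
        using basis_eval_A_leftnormed by blast
      have lv: "length vs = length vs0" using len[OF t] t' by simp
      then obtain i' j' where "\<sigma> v' = Z i' j'" using t' False by auto
      then have "v' \<notin> set vs0" using let0 by auto
      moreover have "v' \<in> insert v (set vs0)" using t(2) t' t0eq by auto
      ultimately have vv: "v' = v" by blast
      then have "set vs = set vs0" using t t' t0eq dist by auto
      then have "map even_var vs = q" using bl[of vs] bt t' vv lv q by (auto split: if_splits)
      then show "\<exists>vs. t = left_normed v vs \<and> map even_var vs = q" using t' vv by blast
    next
      assume "\<exists>vs. t = left_normed v vs \<and> map even_var vs = q"
      then obtain vs where vs: "t = left_normed v vs" "map even_var vs = q" by blast
      then have "set vs = set vs0" using t t0eq dist by auto
      moreover have "length vs = length vs0" using vs q by (metis length_map length_run)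
      ultimately show "basis_eval (A_mul m w) \<sigma> t = Some e" using bl[of vs] vs q by simp
    qed
    then show ?thesis using that 1 2 3 by blast
  qed
qed

section \<open>Deleting the variables that are replaced by the unit\<close>

fun reduct :: "var set \<Rightarrow> tree \<Rightarrow> tree option" where
  "reduct S (Leaf v) = (if v \<in> S then None else Some (Leaf v))"
| "reduct S (Node l r) = (case reduct S l of None \<Rightarrow> reduct S r
    | Some l' \<Rightarrow> (case reduct S r of None \<Rightarrow> Some l' | Some r' \<Rightarrow> Some (Node l' r')))"

lemma leaves_reduct:
  "(case reduct S t of None \<Rightarrow> [] | Some t' \<Rightarrow> leaves t') = filter (\<lambda>v. v \<notin> S) (leaves t)"
  by (induction t) (auto split: option.splits)

lemma reduct_cong: "(\<And>v. v \<in> set (leaves t) \<Longrightarrow> v \<in> S \<longleftrightarrow> v \<in> S') \<Longrightarrow> reduct S t = reduct S' t"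
  by (induction t) (auto cong: option.case_cong)

lemma reduct_empty [simp]: "reduct {} t = Some t"
  by (induction t) auto

text \<open>Unit leaves drop out of every product and the rest is evaluated in A. In values, the
  outer \<open>None\<close> is zero and \<open>Some None\<close> is the unit. The substitution
  \<tau> is free where \<sigma> is the unit, as those variables do not occur in the reduced
  tree.\<close>

lemma basis_eval_U_reduct:
  assumes "\<And>v p. \<sigma> v = Some p \<Longrightarrow> \<tau> v = p"
  shows "basis_eval (U_mul bmul) \<sigma> t = (case reduct {v. \<sigma> v = None} t of None \<Rightarrow> Some None
    | Some t' \<Rightarrow> map_option Some (basis_eval bmul \<tau> t'))"
proof (induction t)
  case (Leaf v)
  then show ?case using assms by (cases "\<sigma> v") auto
next
  case (Node l r)
  let ?S = "{v. \<sigma> v = None}"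
  consider "reduct ?S l = None" | l' where "reduct ?S l = Some l'" "reduct ?S r = None"
    | l' r' where "reduct ?S l = Some l'" "reduct ?S r = Some r'" by fastforce
  then show ?case
  proof cases
    case 1
    then show ?thesis using Node by (cases "basis_eval bmul \<tau> (the (reduct ?S r))") (auto split: option.splits)
  next
    case 2
    then show ?thesis using Node by (cases "basis_eval bmul \<tau> l'") auto
  next
    case 3
    then show ?thesis using Node by (cases "basis_eval bmul \<tau> l'"; cases "basis_eval bmul \<tau> r'") auto
  qed
qed

definition ml_vars :: "nat \<Rightarrow> nat \<Rightarrow> var set" where
  "ml_vars k l = X ` {1..k} \<union> Y ` {1..l}"

lemma card_ml_vars_diff:
  assumes "S \<subseteq> X ` {1..k}"
  shows "card (ml_vars k l - S) = k - card S + l" "card {u \<in> ml_vars k l - S. \<not> even_var u} = l"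
    "card {u \<in> ml_vars k l - S. even_var u} = k - card S" "card S \<le> k"
proof -
  have fS: "finite S" using assms finite_subset by blast
  have cX: "card (X ` {1..k}) = k" by (simp add: card_image inj_on_def)
  have cY: "card (Y ` {1..l}) = l" by (simp add: card_image inj_on_def)
  have eY: "{u \<in> ml_vars k l - S. \<not> even_var u} = Y ` {1..l}" using assms by (auto simp: ml_vars_def)
  have eX: "{u \<in> ml_vars k l - S. even_var u} = X ` {1..k} - S" using assms by (auto simp: ml_vars_def)
  show 2: "card {u \<in> ml_vars k l - S. \<not> even_var u} = l" using eY cY by simp
  show 3: "card {u \<in> ml_vars k l - S. even_var u} = k - card S"
    unfolding eX using assms fS cX by (simp add: card_Diff_subset)
  show "card S \<le> k" using assms cX card_mono[of "X ` {1..k}" S] by simp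
  have eq: "ml_vars k l - S = {u \<in> ml_vars k l - S. even_var u} \<union> {u \<in> ml_vars k l - S. \<not> even_var u}" by auto
  have "card ({u \<in> ml_vars k l - S. even_var u} \<union> {u \<in> ml_vars k l - S. \<not> even_var u})
      = card {u \<in> ml_vars k l - S. even_var u} + card {u \<in> ml_vars k l - S. \<not> even_var u}"
    by (rule card_Un_disjoint) (auto simp: ml_vars_def)
  then have c: "card ({u \<in> ml_vars k l - S. even_var u} \<union> {u \<in> ml_vars k l - S. \<not> even_var u}) = k - card S + l"
    using 2 3 by presburger
  show "card (ml_vars k l - S) = k - card S + l" by (subst eq) (rule c)
qed

definition reduct_class :: "nat \<Rightarrow> nat \<Rightarrow> var set \<Rightarrow> var \<times> bool list \<Rightarrow> tree set" where
  "reduct_class k l S = (\<lambda>(v, q). {t \<in> ml_monomials k l. \<exists>vs. reduct S t = Some (left_normed v vs) \<and> map even_var vs = q})"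

text \<open>If all variables become 1, every monomial has value 1 and there is one class. Otherwise
  one remaining variable is the first one, whence the pattern length with \<open>- 1\<close>; the
  odd variables must fit on the b's of a pattern and possibly the first place, whence
  \<open>+ 1\<close>.\<close>

definition reduct_classes :: "nat \<Rightarrow> (nat \<Rightarrow> nat) \<Rightarrow> nat \<Rightarrow> nat \<Rightarrow> var set \<Rightarrow> tree set set" where
  "reduct_classes m w k l S = (if k - card S + l = 0 then {ml_monomials k l}
    else if l \<le> max_b m w (k - card S + l - 1) + 1
      then reduct_class k l S ` ((ml_vars k l - S) \<times> runs m w (k - card S + l - 1)) else {})"

definition codim_kl_bound :: "nat \<Rightarrow> (nat \<Rightarrow> nat) \<Rightarrow> nat \<Rightarrow> nat \<Rightarrow> nat" where
  "codim_kl_bound m w k l = (if k + l = 0 then 1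
    else if l \<le> max_b m w (k + l - 1) + 1 then (k + l) * card (runs m w (k + l - 1)) else 0)"

lemma card_reduct_classes:
  assumes "S \<subseteq> X ` {1..k}"
  shows "card (reduct_classes m w k l S) \<le> codim_kl_bound m w (k - card S) l" "finite (reduct_classes m w k l S)"
proof -
  have fin: "finite ((ml_vars k l - S) \<times> runs m w (k - card S + l - 1))"
    by (auto simp: ml_vars_def finite_runs)
  then have "card (reduct_class k l S ` ((ml_vars k l - S) \<times> runs m w (k - card S + l - 1)))
      \<le> (k - card S + l) * card (runs m w (k - card S + l - 1))"
    using card_image_le[OF fin] by (simp add: card_cartesian_product card_ml_vars_diff[OF assms])
  then show "card (reduct_classes m w k l S) \<le> codim_kl_bound m w (k - card S) l"
    by (simp add: reduct_classes_def codim_kl_bound_def)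
  show "finite (reduct_classes m w k l S)" using fin by (simp add: reduct_classes_def)
qed

lemma class_in_reduct_classes:
  assumes m: "m \<ge> 1" and g: "graded_subst (A_basis m w) A_even \<tau>" and S: "S \<subseteq> X ` {1..k}"
    and T: "T = {t \<in> ml_monomials k l. case reduct S t of None \<Rightarrow> False | Some t' \<Rightarrow> basis_eval (A_mul m w) \<tau> t' = Some e}"
    and ne: "T \<noteq> {}"
  shows "T \<in> reduct_classes m w k l S"
proof -
  obtain t0 t0' where t0: "t0 \<in> ml_monomials k l" "reduct S t0 = Some t0'" "basis_eval (A_mul m w) \<tau> t0' = Some e"
    using ne unfolding T by (auto split: option.splits)
  have lv: "distinct (leaves t') \<and> set (leaves t') = ml_vars k l - S"
    if "t \<in> ml_monomials k l" "reduct S t = Some t'" for t t'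
    using that leaves_reduct[of S t] by (auto simp: ml_monomials_def ml_vars_def)
  have lv0: "distinct (leaves t0')" "set (leaves t0') = ml_vars k l - S" using lv t0 by blast+
  have card0: "length (leaves t0') = k - card S + l"
    using distinct_card[OF lv0(1)] lv0(2) card_ml_vars_diff[OF S] by simp
  have pos: "k - card S + l \<noteq> 0" using card0 by (metis leaves_nonempty length_0_conv)
  obtain v q where vq: "v \<in> set (leaves t0')" "q \<in> runs m w (length (leaves t0') - 1)"
    "card {u \<in> set (leaves t0'). \<not> even_var u} \<le> num_b q + 1"
    "\<forall>t. distinct (leaves t) \<longrightarrow> set (leaves t) = set (leaves t0') \<longrightarrow>
      basis_eval (A_mul m w) \<tau> t = Some e \<longleftrightarrow> (\<exists>vs. t = left_normed v vs \<and> map even_var vs = q)"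
    using basis_eval_A_class[OF m g lv0(1) t0(3)] by blast
  have "basis_eval (A_mul m w) \<tau> t' = Some e \<longleftrightarrow> (\<exists>vs. t' = left_normed v vs \<and> map even_var vs = q)"
    if "t \<in> ml_monomials k l" "reduct S t = Some t'" for t t'
    using vq(4) lv[OF that] lv0 by simp
  then have "T = reduct_class k l S (v, q)"
    unfolding T reduct_class_def by (auto split: option.splits)
  moreover have "v \<in> ml_vars k l - S" "q \<in> runs m w (k - card S + l - 1)" using vq card0 lv0 by simp_all
  moreover have "l \<le> max_b m w (k - card S + l - 1) + 1"
    using vq(3) lv0(2) card_ml_vars_diff(2)[OF S, of l] num_b_le_max_b[OF vq(2)] card0 by simp
  ultimately show ?thesis using pos by (auto simp: reduct_classes_def)
qed

lemma eval_classes_A_subset: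
  assumes "m \<ge> 1"
  shows "eval_classes (A_basis m w) (A_mul m w) A_even k l \<subseteq> reduct_classes m w k l {}"
proof
  fix T assume "T \<in> eval_classes (A_basis m w) (A_mul m w) A_even k l"
  then obtain \<sigma> e where "graded_subst (A_basis m w) A_even \<sigma>" "T = eval_class (A_mul m w) k l \<sigma> e" "T \<noteq> {}"
    by (auto simp: eval_classes_def)
  then show "T \<in> reduct_classes m w k l {}" using assms
    by (intro class_in_reduct_classes[of m w \<sigma>]) (auto simp: eval_class_def)
qed

text \<open>The classes are sorted by the set S of variables sent to the unit. It contains even
  variables only, because the unit is even.\<close>

lemma eval_classes_U_subset:
  assumes "m \<ge> 1"
  shows "eval_classes (U_basis (A_basis m w)) (U_mul (A_mul m w)) (U_even A_even) k l
    \<subseteq> (\<Union>S\<in>Pow (X ` {1..k}). reduct_classes m w k l S)"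
proof
  fix T assume "T \<in> eval_classes (U_basis (A_basis m w)) (U_mul (A_mul m w)) (U_even A_even) k l"
  then obtain \<sigma> e where g: "graded_subst (U_basis (A_basis m w)) (U_even A_even) \<sigma>"
    and T: "T = eval_class (U_mul (A_mul m w)) k l \<sigma> e" and ne: "T \<noteq> {}"
    by (auto simp: eval_classes_def)
  \<comment> \<open>Restricted to the variables of the monomials, since others may be sent to 1 as
    well. In \<tau>, \<open>Ba\<close> is an even placeholder for the unit, which keeps the
    substitution into A graded.\<close>
  define S where "S = {v \<in> ml_vars k l. \<sigma> v = None}"
  define \<tau> where "\<tau> v = (case \<sigma> v of None \<Rightarrow> Ba | Some p \<Rightarrow> p)" for v
  have Y: "\<sigma> (Y j) = None \<longleftrightarrow> False" for j using g by (metis U_even.simps(1) graded_subst_def)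
  have gX: "\<sigma> (X i) \<in> U_basis (A_basis m w) \<and> U_even A_even (\<sigma> (X i))" 
    and gY: "\<sigma> (Y i) \<in> U_basis (A_basis m w) \<and> \<not> U_even A_even (\<sigma> (Y i))" for i
    using g by (auto simp: graded_subst_def)
  have "\<tau> (X i) \<in> A_basis m w \<and> A_even (\<tau> (X i))" for i
    using gX[of i] by (auto simp: \<tau>_def U_basis_def A_basis_def split: option.splits)
  moreover have "\<tau> (Y i) \<in> A_basis m w \<and> \<not> A_even (\<tau> (Y i))" for i
    using gY[of i] by (auto simp: \<tau>_def U_basis_def A_basis_def split: option.splits)
  ultimately have g\<tau>: "graded_subst (A_basis m w) A_even \<tau>" by (simp add: graded_subst_def)
  have S: "S \<subseteq> X ` {1..k}"
  proof
    fix v assume v: "v \<in> S"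
    show "v \<in> X ` {1..k}"
    proof (cases v)
      case (X i)
      then show ?thesis using v by (auto simp: S_def ml_vars_def)
    next
      case (Y j)
      then show ?thesis using v \<open>\<sigma> (Y j) = None \<longleftrightarrow> False\<close> by (simp add: S_def)
    qed
  qed
  have bev: "basis_eval (U_mul (A_mul m w)) \<sigma> t = (case reduct S t of None \<Rightarrow> Some None
      | Some t' \<Rightarrow> map_option Some (basis_eval (A_mul m w) \<tau> t'))" if "t \<in> ml_monomials k l" for t
  proof -
    have "reduct {v. \<sigma> v = None} t = reduct S t"
      by (rule reduct_cong) (use that in \<open>auto simp: S_def ml_monomials_def ml_vars_def\<close>)
    then show ?thesis using basis_eval_U_reduct[of \<sigma> \<tau> "A_mul m w" t] by (simp add: \<tau>_def)
  qed
  have lr: "reduct S t = None \<longleftrightarrow> ml_vars k l - S = {}" if "t \<in> ml_monomials k l" for t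
  proof -
    have "set (case reduct S t of None \<Rightarrow> [] | Some t' \<Rightarrow> leaves t') = ml_vars k l - S"
      unfolding leaves_reduct using that by (auto simp: ml_monomials_def ml_vars_def)
    then have "ml_vars k l - S = (case reduct S t of None \<Rightarrow> {} | Some t' \<Rightarrow> set (leaves t'))"
      by (auto split: option.splits)
    then show ?thesis by (cases "reduct S t") simp_all
  qed
  have "T \<in> reduct_classes m w k l S"
  proof (cases "ml_vars k l - S = {}")
    case True
    then have "card (ml_vars k l - S) = 0" by (simp only: card.empty)
    then have z: "k - card S + l = 0" using card_ml_vars_diff(1)[OF S, of l] by simp
    have "T = {t \<in> ml_monomials k l. e = None}"
      using T bev lr True by (auto simp: eval_class_def)
    then have "T = ml_monomials k l" using ne by auto
    then show ?thesis using z by (simp add: reduct_classes_def)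
  next
    case False
    then have "reduct S t \<noteq> None" if "t \<in> ml_monomials k l" for t using lr that by blast
    then have "T = {t \<in> ml_monomials k l. case reduct S t of None \<Rightarrow> False | Some t' \<Rightarrow> map_option Some (basis_eval (A_mul m w) \<tau> t') = Some e}"
      using T bev by (fastforce simp: eval_class_def split: option.splits)
    moreover from this ne obtain e' where "e = Some e'" by (auto split: option.splits)
    ultimately have "T = {t \<in> ml_monomials k l. case reduct S t of None \<Rightarrow> False | Some t' \<Rightarrow> basis_eval (A_mul m w) \<tau> t' = Some e'}"
      by (auto split: option.splits)
    then show ?thesis using class_in_reduct_classes[OF assms g\<tau> S _ ne] by simp
  qed
  then show "T \<in> (\<Union>S\<in>Pow (X ` {1..k}). reduct_classes m w k l S)" using S by auto
qed

lemma sum_Pow_card: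
  assumes "finite A"
  shows "(\<Sum>S\<in>Pow A. f (card S)) = (\<Sum>j\<le>card A. (card A choose j) * (f j :: nat))"
proof -
  have "(\<Sum>S\<in>Pow A. f (card S)) = (\<Sum>j\<le>card A. \<Sum>S\<in>{S \<in> Pow A. card S = j}. f (card S))"
    using assms by (intro sum.group[symmetric]) (auto intro: card_mono)
  also have "\<dots> = (\<Sum>j\<le>card A. (card A choose j) * f j)"
  proof (intro sum.cong refl)
    fix j
    have "{S \<in> Pow A. card S = j} = {B. B \<subseteq> A \<and> card B = j}" by auto
    then have "card {S \<in> Pow A. card S = j} = card A choose j" using n_subsets[OF assms] by simp
    then show "(\<Sum>S\<in>{S \<in> Pow A. card S = j}. f (card S)) = (card A choose j) * f j" by simp
  qed
  finally show ?thesis .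
qed

lemma graded_subst_A_ex: "\<exists>\<sigma>. graded_subst (A_basis m w) A_even \<sigma>"
  by (rule exI[of _ "\<lambda>u. if even_var u then Ba else Bb"]) (auto simp: graded_subst_def A_basis_def)

lemma graded_subst_U_ex: "\<exists>\<sigma>. graded_subst (U_basis (A_basis m w)) (U_even A_even) \<sigma>"
  by (rule exI[of _ "\<lambda>u. if even_var u then None else Some Bb"]) (auto simp: graded_subst_def A_basis_def U_basis_def)

lemma gr_codim_kl_A_le:
  assumes "m \<ge> 1"
  shows "gr_codim_kl TYPE('f::field) (A_basis m w) (A_mul m w) A_even k l \<le> codim_kl_bound m w k l"
proof -
  have "gr_codim_kl TYPE('f::field) (A_basis m w) (A_mul m w) A_even k l
      \<le> card (eval_classes (A_basis m w) (A_mul m w) A_even k l)"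
    by (rule gr_codim_kl_le[OF graded_subst_A_ex])
  also have "\<dots> \<le> card (reduct_classes m w k l {})"
    by (rule card_mono[OF _ eval_classes_A_subset[OF assms]]) (simp add: card_reduct_classes)
  also have "\<dots> \<le> codim_kl_bound m w k l" using card_reduct_classes(1)[of "{}" k m w l] by simp
  finally show ?thesis .
qed

text \<open>Each set of j even variables sent to 1 leaves the counting problem of A with k - j even
  and l odd variables.\<close>

lemma gr_codim_kl_U_le:
  assumes "m \<ge> 1"
  shows "gr_codim_kl TYPE('f::field) (U_basis (A_basis m w)) (U_mul (A_mul m w)) (U_even A_even) k l
    \<le> (\<Sum>j\<le>k. (k choose j) * codim_kl_bound m w (k - j) l)"
proof -
  let ?P = "Pow (X ` {1..k})"
  have "gr_codim_kl TYPE('f::field) (U_basis (A_basis m w)) (U_mul (A_mul m w)) (U_even A_even) k l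
      \<le> card (eval_classes (U_basis (A_basis m w)) (U_mul (A_mul m w)) (U_even A_even) k l)"
    by (rule gr_codim_kl_le[OF graded_subst_U_ex])
  also have "\<dots> \<le> card (\<Union>S\<in>?P. reduct_classes m w k l S)"
    by (rule card_mono[OF _ eval_classes_U_subset[OF assms]]) (auto simp: card_reduct_classes)
  also have "\<dots> \<le> (\<Sum>S\<in>?P. card (reduct_classes m w k l S))" by (rule card_UN_le) simp
  also have "\<dots> \<le> (\<Sum>S\<in>?P. codim_kl_bound m w (k - card S) l)" by (intro sum_mono) (auto simp: card_reduct_classes)
  also have "\<dots> = (\<Sum>j\<le>k. (k choose j) * codim_kl_bound m w (k - j) l)"
    using sum_Pow_card[of "X ` {1..k}" "\<lambda>j. codim_kl_bound m w (k - j) l"] by (simp add: card_image inj_on_def)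
  finally show ?thesis .
qed

section \<open>Separating monomials and lower bounds\<close>

lemma card_remove_var:
  assumes "finite V" "v \<in> V"
  shows "card {u \<in> V - {v}. even_var u} = card {u \<in> V. even_var u} - (if even_var v then 1 else 0)"
    "card {u \<in> V - {v}. \<not> even_var u} = card {u \<in> V. \<not> even_var u} - (if even_var v then 0 else 1)"
proof -
  have *: "{u \<in> V - {v}. P u} = (if P v then {u \<in> V. P u} - {v} else {u \<in> V. P u})" for P
    by auto
  show "card {u \<in> V - {v}. even_var u} = card {u \<in> V. even_var u} - (if even_var v then 1 else 0)"
    "card {u \<in> V - {v}. \<not> even_var u} = card {u \<in> V. \<not> even_var u} - (if even_var v then 0 else 1)"
    unfolding * using assms by auto
qed

lemma arrange_vars:
  assumes "finite V" "card {u \<in> V. even_var u} = length (filter id q)" "card {u \<in> V. \<not> even_var u} = num_b q"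
  shows "\<exists>vs. distinct vs \<and> set vs = V \<and> map even_var vs = q"
  using assms
proof (induction q arbitrary: V)
  case Nil
  then have "{u \<in> V. even_var u} = {}" "{u \<in> V. \<not> even_var u} = {}" by simp_all
  then have "V = {}" by blast
  then show ?case by simp
next
  case (Cons b q)
  have "card {u \<in> V. even_var u = b} \<noteq> 0" using Cons.prems by (cases b) auto
  then have "{u \<in> V. even_var u = b} \<noteq> {}" by (metis card.empty)
  then obtain v where v: "v \<in> V" "even_var v = b" by blast
  have "card {u \<in> V - {v}. even_var u} = length (filter id q)" "card {u \<in> V - {v}. \<not> even_var u} = num_b q"
    using card_remove_var[OF Cons.prems(1) v(1)] Cons.prems(2,3) v(2) by (auto simp: id_def)
  then obtain vs where "distinct vs" "set vs = V - {v}" "map even_var vs = q"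
    using Cons.IH[of "V - {v}"] Cons.prems(1) by blast
  then show ?case using v by (intro exI[of _ "v # vs"]) auto
qed

section \<open>Vanishing of padded monomials in A^#\<close>

lemma basis_eval_U_Some:
  "(\<And>u. u \<in> set (leaves t) \<Longrightarrow> \<sigma> u = Some (\<tau> u)) \<Longrightarrow> basis_eval (U_mul bmul) \<sigma> t = map_option Some (basis_eval bmul \<tau> t)"
proof (induction t)
  case (Node l r)
  then show ?case by (cases "basis_eval bmul \<tau> l"; cases "basis_eval bmul \<tau> r") auto
qed simp

lemma U_mul_None: "U_mul bmul p q = Some None \<Longrightarrow> p = None \<and> q = None"
  by (cases "(bmul, p, q)" rule: U_mul.cases) auto

lemma basis_eval_U_unit:
  "basis_eval (U_mul bmul) \<sigma> t = Some None \<Longrightarrow> u \<in> set (leaves t) \<Longrightarrow> \<sigma> u = None"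
  by (induction t) (auto simp: bind_eq_Some_conv dest: U_mul_None)

lemma U_mul_A_letter:
  assumes "U_mul (A_mul m w) p q = Some r" "\<And>i j. r \<noteq> Some (Z i j)"
  shows "p = None \<and> q = r \<or> q = None \<and> p = r"
proof (cases p)
  case None
  then show ?thesis using assms by simp
next
  case (Some p')
  show ?thesis
  proof (cases q)
    case None
    then show ?thesis using assms Some by simp
  next
    case q: (Some q')
    then obtain e where "A_mul m w p' q' = Some e" "r = Some e" using assms(1) Some by auto
    then show ?thesis using assms(2) by (blast elim: A_mul_Some)
  qed
qed

text \<open>A value that is 1 or a letter is never a product of two non-units, so at each node one
  factor is 1 and the other carries the value; at most one leaf is then different from 1.\<close>

lemma basis_eval_U_letter:
  assumes "basis_eval (U_mul (A_mul m w)) \<sigma> t = Some r" "\<And>i j. r \<noteq> Some (Z i j)"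
    "u \<in> set (leaves t)" "u' \<in> set (leaves t)" "\<sigma> u \<noteq> None" "\<sigma> u' \<noteq> None"
  shows "u = u'"
  using assms
proof (induction t arbitrary: r)
  case (Leaf v)
  then show ?case by simp
next
  case (Node l r')
  obtain p q where pq: "basis_eval (U_mul (A_mul m w)) \<sigma> l = Some p" "basis_eval (U_mul (A_mul m w)) \<sigma> r' = Some q"
    "U_mul (A_mul m w) p q = Some r"
    using Node.prems(1) by (auto simp: bind_eq_Some_conv)
  from U_mul_A_letter[OF pq(3) Node.prems(2)] show ?case
  proof
    assume a: "p = None \<and> q = r"
    then have "u \<in> set (leaves r')" "u' \<in> set (leaves r')"
      using basis_eval_U_unit[of "A_mul m w" \<sigma> l] pq(1) Node.prems by auto
    then show ?thesis using Node.IH(2)[of r] pq(2) a Node.prems by blast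
  next
    assume a: "q = None \<and> p = r"
    then have "u \<in> set (leaves l)" "u' \<in> set (leaves l)"
      using basis_eval_U_unit[of "A_mul m w" \<sigma> r'] pq(2) Node.prems by auto
    then show ?thesis using Node.IH(1)[of r] pq(1) a Node.prems by blast
  qed
qed

definition pad :: "var list \<Rightarrow> tree \<Rightarrow> tree" where
  "pad xs t = foldr (\<lambda>x. Node (Leaf x)) xs t"

lemma leaves_pad [simp]: "leaves (pad xs t) = xs @ leaves t"
  by (induction xs) (auto simp: pad_def)

lemma basis_eval_pad_unit:
  "(\<And>x. x \<in> set xs \<Longrightarrow> \<sigma> x = None) \<Longrightarrow> basis_eval (U_mul bmul) \<sigma> (pad xs t) = basis_eval (U_mul bmul) \<sigma> t"
proof (induction xs)
  case (Cons x xs)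
  then show ?case by (cases "basis_eval (U_mul bmul) \<sigma> t") (auto simp: pad_def)
qed (simp add: pad_def)

text \<open>Left multiplication by a non-unit kills every value that involves two non-unit leaves.\<close>

lemma basis_eval_pad_None:
  assumes "x \<in> set xs" "\<sigma> x \<noteq> None" and u: "u \<in> set (leaves t)" "u' \<in> set (leaves t)" "u \<noteq> u'"
    "\<sigma> u \<noteq> None" "\<sigma> u' \<noteq> None"
  shows "basis_eval (U_mul (A_mul m w)) \<sigma> (pad xs t) = None"
  using assms(1)
proof (induction xs)
  case (Cons y ys)
  let ?B = "basis_eval (U_mul (A_mul m w)) \<sigma>"
  have pad: "pad (y # ys) t = Node (Leaf y) (pad ys t)" by (simp add: pad_def)
  show ?case
  proof (cases "x \<in> set ys")
    case True
    then show ?thesis using Cons.IH pad by (cases "\<sigma> y") auto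
  next
    case False
    then have y: "y = x" using Cons.prems by simp
    obtain p where p: "\<sigma> x = Some p" using assms(2) by blast
    show ?thesis
    proof (cases "?B (pad ys t)")
      case None
      then show ?thesis using pad by simp
    next
      case (Some r)
      \<comment> \<open>\<open>pad ys t\<close> still contains the non-unit leaves u and u', so a
        nonzero value is neither 1 nor a letter. It is a z, which no basis element of A multiplies
        from the left.\<close>
      have "\<exists>i j. r = Some (Z i j)"
        using basis_eval_U_letter[OF Some, of u u'] u by auto
      then obtain i j where r: "r = Some (Z i j)" by blast
      have "A_mul m w p (Z i j) = None" by (cases p) auto
      then show ?thesis using pad Some r p y by simp
    qed
  qed
qed simp

section \<open>Monomials that realise a given pattern\<close>

lemma witness_vars:
  assumes q: "q = run m w i j n" and V: "finite V"
    and cX: "card {u \<in> V. even_var u} = length (filter id q) + (if odd i then 1 else 0)"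
    and cY: "card {u \<in> V. \<not> even_var u} = num_b q + (if odd i then 0 else 1)"
  shows "\<exists>v vs. distinct (v # vs) \<and> set (v # vs) = V \<and> map even_var vs = q \<and> even_var v = odd i"
proof -
  have "card {u \<in> V. even_var u = odd i} \<noteq> 0" using cX cY by (cases "odd i") auto
  then have "{u \<in> V. even_var u = odd i} \<noteq> {}" by (metis card.empty)
  then obtain v where v: "v \<in> V" "even_var v = odd i" by blast
  have "card {u \<in> V - {v}. even_var u} = length (filter id q)" "card {u \<in> V - {v}. \<not> even_var u} = num_b q"
    using card_remove_var[OF V v(1)] cX cY v(2) by auto
  then obtain vs where "distinct vs" "set vs = V - {v}" "map even_var vs = q"
    using arrange_vars[of "V - {v}" q] V by blast
  then show ?thesis using v by (intro exI[of _ v] exI[of _ vs]) auto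
qed

lemma graded_subst_A_point:
  assumes "1 \<le> i" "1 \<le> j" "j \<le> m + w i" "even_var v = odd i"
  shows "graded_subst (A_basis m w) A_even (\<lambda>u. if u = v then Z i j else if even_var u then Ba else Bb)"
  using assms by (auto simp: graded_subst_def A_basis_def)

lemma length_filter_id: "length (filter id q) = length q - num_b q" "num_b q \<le> length q"
  using sum_length_filter_compl[of id q] by (simp_all add: id_def)

text \<open>The number of odd variables in a monomial whose first variable takes a value
  \<open>z_j^(i)\<close> and whose other variables follow \<open>q\<close>: the element
  \<open>z_j^(i)\<close> is odd exactly for even i.\<close>

definition odds :: "nat \<Rightarrow> bool list \<Rightarrow> nat" where
  "odds i q = num_b q + (if odd i then 0 else 1)"

lemma gr_codim_kl_A_ge:
  assumes m: "m \<ge> 1" and v: "1 \<le> i" "1 \<le> j" "j \<le> m + w i" and q: "q = run m w i j n" 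
    and l: "l = odds i q" and k: "k + l = n + 1"
  shows "gr_codim_kl TYPE('f::field) (A_basis m w) (A_mul m w) A_even k l \<ge> 1"
proof -
  have sub: "({} :: var set) \<subseteq> X ` {1..k}" by simp
  have cv: "card {u \<in> ml_vars k l. even_var u} = k" "card {u \<in> ml_vars k l. \<not> even_var u} = l"
    using card_ml_vars_diff(2,3)[OF sub, of l] by simp_all
  have lq: "length q = n" using q by simp
  have "\<exists>v vs. distinct (v # vs) \<and> set (v # vs) = ml_vars k l \<and> map even_var vs = q \<and> even_var v = odd i"
    by (rule witness_vars[OF q]) (use cv k l length_filter_id[of q] lq in \<open>auto simp: ml_vars_def odds_def\<close>)
  then obtain v vs where vs: "distinct (v # vs)" "set (v # vs) = ml_vars k l" "map even_var vs = q" "even_var v = odd i"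
    by blast
  let ?\<sigma> = "\<lambda>u. if u = v then Z i j else if even_var u then Ba else Bb"
  have len: "length vs = n" using vs(3) lq by (metis length_map)
  have "basis_eval (A_mul m w) ?\<sigma> (left_normed v vs) = (if map even_var vs = run m w i j (length vs)
      then Some (target m w i j (length vs)) else None)"
    by (rule basis_eval_left_normed) (use vs v m in auto)
  then have b: "basis_eval (A_mul m w) ?\<sigma> (left_normed v vs) \<noteq> None" using vs(3) q len by simp
  have t: "left_normed v vs \<in> ml_monomials k l" using vs(1,2) by (simp add: ml_monomials_def ml_vars_def)
  have "card {()} \<le> gr_codim_kl TYPE('f::field) (A_basis m w) (A_mul m w) A_even k l"
    by (rule gr_codim_kl_ge[where \<sigma> = "\<lambda>_. ?\<sigma>" and t = "\<lambda>_. left_normed v vs"])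
      (use t b graded_subst_A_point[of i j m w v, OF v vs(4)] in auto)
  then show ?thesis by simp
qed

text \<open>There is one padded monomial for every set of s even variables, tested by the
  substitution that sends exactly this set to 1. Different sets of equal size do not contain each
  other, so the padding of one always has a non-unit variable under the substitution of the
  other.\<close>

lemma gr_codim_kl_U_ge:
  assumes m: "m \<ge> 1" and v: "1 \<le> i" "1 \<le> j" "j \<le> m + w i" and q: "q = run m w i j n" 
    and l: "l = odds i q" and k: "k + l = n + 1" and l2: "l \<ge> 2"
  shows "gr_codim_kl TYPE('f::field) (U_basis (A_basis m w)) (U_mul (A_mul m w)) (U_even A_even) (k + s) l
    \<ge> (k + s) choose s"
proof -
  let ?J = "{S. S \<subseteq> X ` {1..k+s} \<and> card S = s}"
  have lq: "length q = n" using q by simp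
  have "\<forall>S. \<exists>v vs. S \<in> ?J \<longrightarrow> distinct (v # vs) \<and> set (v # vs) = ml_vars (k + s) l - S \<and> map even_var vs = q \<and> even_var v = odd i"
  proof (intro allI)
    fix S
    show "\<exists>v vs. S \<in> ?J \<longrightarrow> distinct (v # vs) \<and> set (v # vs) = ml_vars (k + s) l - S \<and> map even_var vs = q \<and> even_var v = odd i"
    proof (cases "S \<in> ?J")
      case S: True
      have sub: "S \<subseteq> X ` {1..k+s}" "card S = s" using S by auto
      have "card {u \<in> ml_vars (k + s) l - S. even_var u} = k" "card {u \<in> ml_vars (k + s) l - S. \<not> even_var u} = l"
        using card_ml_vars_diff(2,3)[OF sub(1), of l] sub(2) by simp_all
      then have "\<exists>v vs. distinct (v # vs) \<and> set (v # vs) = ml_vars (k + s) l - S \<and> map even_var vs = q \<and> even_var v = odd i"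
        by (intro witness_vars[OF q]) (use k l length_filter_id[of q] lq in \<open>auto simp: ml_vars_def odds_def\<close>)
      then show ?thesis by blast
    qed blast
  qed
  then have "\<exists>v vs. \<forall>S. S \<in> ?J \<longrightarrow> distinct (v S # vs S) \<and> set (v S # vs S) = ml_vars (k + s) l - S
      \<and> map even_var (vs S) = q \<and> even_var (v S) = odd i"
    unfolding choice_iff .
  then obtain v vs where *: "\<forall>S. S \<in> ?J \<longrightarrow> distinct (v S # vs S) \<and> set (v S # vs S) = ml_vars (k + s) l - S
      \<and> map even_var (vs S) = q \<and> even_var (v S) = odd i"
    by (elim exE)
  have vs: "distinct (v S # vs S)" "set (v S # vs S) = ml_vars (k + s) l - S"
    "map even_var (vs S) = q" "even_var (v S) = odd i" if "S \<in> ?J" for S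
    using *[rule_format, OF that] by - (elim conjE, assumption)+
  have "\<exists>xs. distinct xs \<and> set xs = S" if "S \<in> ?J" for S
    using that finite_distinct_list[of S] finite_subset[of S "X ` {1..k+s}"] by auto
  then obtain xs where xs: "\<And>S. S \<in> ?J \<Longrightarrow> distinct (xs S) \<and> set (xs S) = S" by metis
  define t where "t S = pad (xs S) (left_normed (v S) (vs S))" for S
  define \<tau> where "\<tau> S = (\<lambda>u. if u = v S then Z i j else if even_var u then Ba else Bb)" for S
  define \<sigma> where "\<sigma> S = (\<lambda>u. if u \<in> S then None else Some (\<tau> S u))" for S
  have tml: "t S \<in> ml_monomials (k + s) l" if S: "S \<in> ?J" for S
  proof -
    have "S \<subseteq> ml_vars (k + s) l" using S by (auto simp: ml_vars_def)
    moreover have "distinct (xs S)" "set (xs S) = S" using xs[OF S] by auto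
    ultimately show ?thesis using vs(1,2)[OF S]
      by (auto simp: t_def ml_monomials_def ml_vars_def)
  qed
  have gs: "graded_subst (U_basis (A_basis m w)) (U_even A_even) (\<sigma> S)" if S: "S \<in> ?J" for S
  proof -
    have "graded_subst (A_basis m w) A_even (\<tau> S)" unfolding \<tau>_def by (rule graded_subst_A_point[of i j m w "v S", OF v vs(4)[OF S]])
    then show ?thesis using S by (auto simp: graded_subst_def \<sigma>_def U_basis_def)
  qed
  have diag: "basis_eval (U_mul (A_mul m w)) (\<sigma> S) (t S) \<noteq> None" if S: "S \<in> ?J" for S
  proof -
    have len: "length (vs S) = n" using vs(3)[OF S] lq by (metis length_map)
    have "basis_eval (U_mul (A_mul m w)) (\<sigma> S) (t S) = basis_eval (U_mul (A_mul m w)) (\<sigma> S) (left_normed (v S) (vs S))"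
      unfolding t_def by (rule basis_eval_pad_unit) (use xs[OF S] in \<open>simp add: \<sigma>_def\<close>)
    also have "\<dots> = map_option Some (basis_eval (A_mul m w) (\<tau> S) (left_normed (v S) (vs S)))"
      by (rule basis_eval_U_Some) (use vs(2)[OF S] in \<open>auto simp: \<sigma>_def\<close>)
    also have "basis_eval (A_mul m w) (\<tau> S) (left_normed (v S) (vs S)) = (if map even_var (vs S) = run m w i j (length (vs S))
      then Some (target m w i j (length (vs S))) else None)"
      by (rule basis_eval_left_normed) (use vs(1)[OF S] v m in \<open>auto simp: \<tau>_def\<close>)
    finally show ?thesis using vs(3)[OF S] q len by simp
  qed
  have off: "basis_eval (U_mul (A_mul m w)) (\<sigma> S) (t S') = None" if S: "S \<in> ?J" "S' \<in> ?J" "S' \<noteq> S" for S S'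
  proof -
    have "finite S" using S(1) finite_subset[of S "X ` {1..k+s}"] by auto
    then have "\<not> S' \<subseteq> S" using S card_subset_eq[of S S'] by auto
    then obtain x where x: "x \<in> S'" "x \<notin> S" by blast
    have YS: "Y h \<notin> S" "Y h \<notin> S'" for h using S by auto
    \<comment> \<open>Odd variables are never sent to 1, so \<open>Y 1\<close> and
      \<open>Y 2\<close> are two non-unit leaves of the inner monomial; this is where
      \<open>l \<ge> 2\<close> enters.\<close>
    have "Y 1 \<in> set (leaves (left_normed (v S') (vs S')))" "Y 2 \<in> set (leaves (left_normed (v S') (vs S')))"
      using vs(2)[OF S(2)] YS l2 by (auto simp: ml_vars_def)
    then show ?thesis unfolding t_def
      by (intro basis_eval_pad_None[of x _ _ "Y 1" _ "Y 2"]) (use x xs[OF S(2)] YS in \<open>auto simp: \<sigma>_def\<close>)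
  qed
  have "card ?J \<le> gr_codim_kl TYPE('f::field) (U_basis (A_basis m w)) (U_mul (A_mul m w)) (U_even A_even) (k + s) l"
  proof (rule gr_codim_kl_ge[where \<sigma> = \<sigma> and t = t])
    have "?J \<subseteq> Pow (X ` {1..k+s})" by auto
    then show "finite ?J" by (rule finite_subset) simp
  qed (use tml gs diag off in blast)+
  moreover have "card ?J = (k + s) choose s"
    using n_subsets[of "X ` {1..k+s}" s] by (simp add: card_image inj_on_def)
  ultimately show ?thesis by simp
qed

section \<open>Growth rates\<close>

text \<open>The factor \<open>real n\<close> in the lower bound is harmless, its n-th root tending
  to 1. It pays for estimating a sum of about n terms through a bound on each single term.\<close>

lemma root_tendsto_squeeze:
  fixes f :: "nat \<Rightarrow> real"
  assumes L: "L > 0" and nn: "\<And>n. f n \<ge> 0"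
    and up: "\<And>r. r > L \<Longrightarrow> \<exists>A>0. \<forall>\<^sub>F n in sequentially. f n \<le> A * r ^ n"
    and lo: "\<And>r. 0 < r \<Longrightarrow> r < L \<Longrightarrow> \<exists>a>0. \<forall>\<^sub>F n in sequentially. a * r ^ n \<le> real n * f n"
  shows "(\<lambda>n. root n (f n)) \<longlonglongrightarrow> L"
proof (rule order_tendstoI)
  fix y assume y: "L < y"
  then obtain r where r: "L < r" "r < y" using dense by blast
  obtain A where A: "A > 0" "\<forall>\<^sub>F n in sequentially. f n \<le> A * r ^ n" using up[OF r(1)] by blast
  have "(\<lambda>n. root n A * r) \<longlonglongrightarrow> 1 * r" using A by (intro tendsto_mult LIMSEQ_root_const tendsto_const)
  then have "\<forall>\<^sub>F n in sequentially. root n A * r < y" using r by (intro order_tendstoD(2)) auto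
  with A(2) eventually_gt_at_top[of 0] show "\<forall>\<^sub>F n in sequentially. root n (f n) < y"
  proof eventually_elim
    case (elim n)
    have "root n (f n) \<le> root n (A * r ^ n)" using elim by simp
    also have "\<dots> = root n A * r" using elim r L by (simp add: real_root_mult real_root_power_cancel)
    finally show ?case using elim by simp
  qed
next
  fix y assume y: "y < L"
  then obtain r where r: "max y 0 < r" "r < L" using dense[of "max y 0" L] L by auto
  then obtain a where a: "a > 0" "\<forall>\<^sub>F n in sequentially. a * r ^ n \<le> real n * f n" using lo[of r] by auto
  have "(\<lambda>n. root n a * r / root n (real n)) \<longlonglongrightarrow> 1 * r / 1"
    using a by (intro tendsto_mult tendsto_divide LIMSEQ_root_const LIMSEQ_root tendsto_const) auto
  then have "\<forall>\<^sub>F n in sequentially. y < root n a * r / root n (real n)" using r by (intro order_tendstoD(1)) auto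
  with a(2) eventually_gt_at_top[of 0] show "\<forall>\<^sub>F n in sequentially. y < root n (f n)"
  proof eventually_elim
    case (elim n)
    have pos: "root n (real n) > 0" using elim by simp
    have "root n a * r = root n (a * r ^ n)" using elim r by (simp add: real_root_mult real_root_power_cancel)
    also have "\<dots> \<le> root n (real n * f n)" using elim by simp
    also have "\<dots> = root n (real n) * root n (f n)" by (rule real_root_mult)
    finally have "root n a * r / root n (real n) \<le> root n (f n)" using pos by (simp add: field_simps)
    then show ?case using elim by simp
  qed
qed

lemma binomial_shift_le: "M choose i \<le> (M + c) choose (i + c)"
proof (induction c)
  case (Suc c)
  have "(M + c) choose (i + c) \<le> Suc (M + c) choose Suc (i + c)" by simp
  with Suc show ?case by (metis add_Suc_right order_trans)
qed simp

text \<open>\<open>c\<close> and \<open>C\<close> stand for the codimensions of A and A^#, with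
  \<open>V\<close> bounding from above and \<open>d\<close> from below. The binomial theorem turns
  growth rate L of both bounds into rate 1 + L. From below, C dominates only each single term of the
  binomial sum, so it is multiplied by the number of terms.\<close>

lemma roots_binomial_transform:
  fixes c C V d :: "nat \<Rightarrow> real"
  assumes L: "L > 0"
    and up: "\<And>r. r > L \<Longrightarrow> \<forall>\<^sub>F N in sequentially. V N \<le> r ^ N"
    and lo: "\<And>r. 0 < r \<Longrightarrow> r < L \<Longrightarrow> \<forall>\<^sub>F N in sequentially. r ^ N \<le> d N"
    and nn: "\<And>N. c N \<ge> 0" "\<And>N. C N \<ge> 0"
    and cV: "\<And>N. c N \<le> V N" and dc: "\<forall>\<^sub>F N in sequentially. d N \<le> c N"
    and CV: "\<And>n. C n \<le> (\<Sum>j\<le>n. real (n choose j) * V (n - j))"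
    and dC: "\<And>n N. N0 \<le> N \<Longrightarrow> N \<le> n \<Longrightarrow> real (n choose N) * d N \<le> C n"
  shows "(\<lambda>n. root n (c n)) \<longlonglongrightarrow> L" "(\<lambda>n. root n (C n)) \<longlonglongrightarrow> 1 + L"
proof -
  show "(\<lambda>n. root n (c n)) \<longlonglongrightarrow> L"
  proof (rule root_tendsto_squeeze[OF L nn(1)])
    fix r assume "L < r"
    from up[OF this] have "\<forall>\<^sub>F N in sequentially. c N \<le> 1 * r ^ N"
      by eventually_elim (use cV order_trans in fastforce)
    then show "\<exists>A>0. \<forall>\<^sub>F n in sequentially. c n \<le> A * r ^ n" using zero_less_one by blast
  next
    fix r :: real assume r: "0 < r" "r < L"
    from lo[OF r] dc eventually_ge_at_top[of 1]
    have "\<forall>\<^sub>F n in sequentially. 1 * r ^ n \<le> real n * c n"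
    proof eventually_elim
      case (elim n)
      have "1 * c n \<le> real n * c n" using elim nn by (intro mult_right_mono) auto
      then show ?case using elim by simp
    qed
    then show "\<exists>a>0. \<forall>\<^sub>F n in sequentially. a * r ^ n \<le> real n * c n" using zero_less_one by blast
  qed
  have "1 + L > 0" using L by simp
  then show "(\<lambda>n. root n (C n)) \<longlonglongrightarrow> 1 + L"
  proof (rule root_tendsto_squeeze[OF _ nn(2)])
    fix R assume R: "1 + L < R"
    define r where "r = R - 1"
    have r: "r > L" using R r_def by simp
    obtain M where M: "\<And>N. N \<ge> M \<Longrightarrow> V N \<le> r ^ N" using up[OF r] by (auto simp: eventually_sequentially)
    \<comment> \<open>\<open>D\<close> absorbs the finitely many N < M at which \<open>V N\<close>
      may exceed \<open>r ^ N\<close>.\<close>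
    define D where "D = 1 + (\<Sum>N<M. \<bar>V N\<bar> / r ^ N)"
    have r0: "r > 0" using r L by simp
    have D1: "D \<ge> 1" unfolding D_def using r0 by (simp add: sum_nonneg)
    have VD: "V N \<le> D * r ^ N" for N
    proof (cases "N < M")
      case True
      have "\<bar>V N\<bar> / r ^ N \<le> (\<Sum>N<M. \<bar>V N\<bar> / r ^ N)"
        using True r0 by (intro member_le_sum) auto
      then have "\<bar>V N\<bar> / r ^ N \<le> D" by (simp add: D_def)
      then have "\<bar>V N\<bar> \<le> D * r ^ N" using r0 by (simp add: field_simps)
      then show ?thesis by simp
    next
      case False
      then have "V N \<le> 1 * r ^ N" using M by simp
      also have "\<dots> \<le> D * r ^ N" using D1 r0 by (intro mult_right_mono) auto
      finally show ?thesis .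
    qed
    have "C n \<le> D * R ^ n" for n
    proof -
      have "C n \<le> (\<Sum>j\<le>n. real (n choose j) * V (n - j))" by (rule CV)
      also have "\<dots> \<le> (\<Sum>j\<le>n. real (n choose j) * (D * r ^ (n - j)))"
        by (intro sum_mono mult_left_mono VD) auto
      also have "\<dots> = D * (\<Sum>j\<le>n. real (n choose j) * 1 ^ j * r ^ (n - j))"
        by (simp add: sum_distrib_left mult_ac)
      also have "\<dots> = D * (1 + r) ^ n" by (simp only: binomial_ring)
      finally show ?thesis by (simp add: r_def)
    qed
    then show "\<exists>A>0. \<forall>\<^sub>F n in sequentially. C n \<le> A * R ^ n" using D1
      by (intro exI[of _ D]) auto
  next
    fix R assume R: "0 < R" "R < 1 + L"
    \<comment> \<open>The maximum with \<open>L / 2\<close> keeps r positive when R \<le> 1.\<close>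
    define r where "r = max (R - 1) (L / 2)"
    have r: "0 < r" "r < L" "R \<le> 1 + r" using R L by (auto simp: r_def)
    obtain M where M: "\<And>N. N \<ge> M \<Longrightarrow> r ^ N \<le> d N" using lo[OF r(1,2)] by (auto simp: eventually_sequentially)
    define K where "K = max M N0"
    \<comment> \<open>The bound on \<open>d\<close> is available from index K on, so the binomial
      sum is shifted by K; this costs \<open>r ^ K / (1 + r) ^ K\<close>. The further 1/2 absorbs n
      - K + 1 \<le> 2 n.\<close>
    define a where "a = r ^ K / (1 + r) ^ K / 2"
    have a0: "a > 0" using r by (simp add: a_def)
    have "a * R ^ n \<le> real n * C n" if n: "n \<ge> K" "n \<ge> 1" for n
    proof -
      have "2 * (a * (1 + r) ^ n) = r ^ K * (1 + r) ^ (n - K)"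
      proof -
        have "(1 + r) ^ n = (1 + r) ^ K * (1 + r) ^ (n - K)" using n by (simp flip: power_add)
        then show ?thesis using r by (simp add: a_def)
      qed
      also have "\<dots> = r ^ K * (\<Sum>i\<le>n - K. real ((n - K) choose i) * r ^ i * 1 ^ (n - K - i))"
        by (simp only: binomial_ring add.commute[of 1 r])
      also have "\<dots> = (\<Sum>i\<le>n - K. real ((n - K) choose i) * r ^ (i + K))"
        by (simp add: sum_distrib_left power_add mult_ac)
      also have "\<dots> \<le> (\<Sum>i\<le>n - K. C n)"
      proof (rule sum_mono)
        fix i assume i: "i \<in> {..n - K}"
        have "real ((n - K) choose i) * r ^ (i + K) \<le> real (n choose (i + K)) * d (i + K)"
        proof (rule mult_mono)
          show "real ((n - K) choose i) \<le> real (n choose (i + K))"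
            using binomial_shift_le[of "n - K" i K] n by simp
          show "r ^ (i + K) \<le> d (i + K)" by (rule M) (simp add: K_def)
        qed (use r in auto)
        also have "\<dots> \<le> C n" by (rule dC) (use i n in \<open>auto simp: K_def\<close>)
        finally show "real ((n - K) choose i) * r ^ (i + K) \<le> C n" .
      qed
      also have "\<dots> = real (n - K + 1) * C n" by simp
      also have "\<dots> \<le> (2 * real n) * C n" using n nn by (intro mult_right_mono) auto
      finally have "a * (1 + r) ^ n \<le> real n * C n" by simp
      moreover have "a * R ^ n \<le> a * (1 + r) ^ n" using a0 r R by (intro mult_left_mono power_mono) auto
      ultimately show ?thesis by simp
    qed
    then show "\<exists>a>0. \<forall>\<^sub>F n in sequentially. a * R ^ n \<le> real n * C n"
      using a0 eventually_ge_at_top[of "max K 1"] by (intro exI[of _ a]) (auto elim: eventually_mono)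
  qed
qed

section \<open>Subadditive sequences and entropy estimates for binomials\<close>

lemma fekete:
  fixes K :: "nat \<Rightarrow> nat"
  assumes sub: "\<And>a b. K (a + b) \<le> K a + K b"
  shows "convergent (\<lambda>n. real (K n) / real n)"
proof -
  let ?f = "\<lambda>n. real (K n) / real n"
  define p where "p = Inf (?f ` {1..})"
  have bdd: "bdd_below (?f ` {1..})" by (rule bdd_belowI[of _ 0]) auto
  have mult: "K (q * a + b) \<le> q * K a + K b" for q a b
  proof (induction q)
    case (Suc q)
    have "K (Suc q * a + b) \<le> K a + K (q * a + b)" using sub[of a "q * a + b"] by (simp add: add.assoc)
    with Suc show ?case by simp
  qed simp
  have "?f \<longlonglongrightarrow> p"
  proof (rule order_tendstoI)
    fix y assume "y < p"
    have "p \<le> ?f n" if "n \<ge> 1" for n unfolding p_def using that bdd by (intro cInf_lower) auto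
    then show "\<forall>\<^sub>F n in sequentially. y < ?f n" using \<open>y < p\<close>
      by (intro eventually_sequentiallyI[of 1]) (rule less_le_trans)
  next
    fix y assume "p < y"
    then obtain a where a: "a \<ge> 1" "?f a < y" unfolding p_def using cInf_lessD[of "?f ` {1..}" y] by auto
    \<comment> \<open>Bounds the contribution of the remainder of n modulo a, which disappears after
      division by n.\<close>
    define M where "M = Max (K ` {..<a})"
    have "(\<lambda>n. ?f a + real M * inverse (real n)) \<longlonglongrightarrow> ?f a + real M * 0"
      by (intro tendsto_intros lim_inverse_n)
    then have "\<forall>\<^sub>F n in sequentially. ?f a + real M * inverse (real n) < y"
      using a by (intro order_tendstoD(2)) auto
    with eventually_ge_at_top[of 1] show "\<forall>\<^sub>F n in sequentially. ?f n < y"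
    proof eventually_elim
      case (elim n)
      have "K (n mod a) \<le> M" unfolding M_def using a by (intro Max_ge) auto
      then have "K n \<le> (n div a) * K a + M" using mult[of "n div a" a "n mod a"] by simp
      then have "real (K n) \<le> real (n div a) * real (K a) + real M"
        by (metis of_nat_add of_nat_le_iff of_nat_mult)
      also have "real (n div a) \<le> real n / real a" 
      proof -
        have "real ((n div a) * a) \<le> real n" by (subst of_nat_le_iff) simp
        then show ?thesis using a by (simp add: field_simps)
      qed
      finally have "real (K n) \<le> real n / real a * real (K a) + real M" by (simp add: mult_right_mono)
      then have "?f n \<le> ?f a + real M * inverse (real n)" using elim a by (simp add: field_simps)
      then show ?case using elim by simp
    qed
  qed
  then show ?thesis by (auto simp: convergent_def)
qed

text \<open>Stirling's formula up to an error of order ln n, which is lost on division by n. The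
  increments in both inductions reduce to ln (1 + t) \<le> t.\<close>

lemma ln_fact_bounds:
  "real n * ln (real n) - real n \<le> ln (fact n)" "ln (fact n) \<le> (real n + 1) * ln (real n + 1) - real n"
proof -
  show "real n * ln (real n) - real n \<le> ln (fact n)"
  proof (induction n)
    case (Suc n)
    have "real n * (ln (real n + 1) - ln (real n)) \<le> 1"
    proof (cases "n = 0")
      case False
      have "ln (real n + 1) - ln (real n) = ln (1 + 1 / real n)"
        using False ln_div[of "real n + 1" "real n"] by (simp add: add_divide_distrib)
      also have "\<dots> \<le> 1 / real n" by (rule ln_add_one_self_le_self) simp
      finally show ?thesis using False by (simp add: field_simps)
    qed simp
    moreover have "ln (fact (Suc n) :: real) = ln (real n + 1) + ln (fact n)"
      by (simp add: ln_mult add.commute del: of_nat_Suc)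
    ultimately show ?case using Suc by (simp add: algebra_simps)
  qed simp
  show "ln (fact n) \<le> (real n + 1) * ln (real n + 1) - real n"
  proof (induction n)
    case (Suc n)
    have "ln (real n + 1) - ln (real n + 2) = ln ((real n + 1) / (real n + 2))"
      by (simp add: ln_div)
    also have "\<dots> \<le> (real n + 1) / (real n + 2) - 1" by (rule ln_le_minus_one) simp
    also have "\<dots> = - (1 / (real n + 2))" by (simp add: field_simps)
    finally have "1 / (real n + 2) \<le> ln (real n + 2) - ln (real n + 1)" by simp
    then have "1 \<le> (real n + 2) * (ln (real n + 2) - ln (real n + 1))" by (simp add: field_simps)
    moreover have "ln (fact (Suc n) :: real) = ln (real n + 1) + ln (fact n)"
      by (simp add: ln_mult add.commute del: of_nat_Suc)
    ultimately show ?case using Suc by (simp add: algebra_simps)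
  qed simp
qed

lemma lim_ln_over_n: "(\<lambda>n. ln (real n) / real n) \<longlonglongrightarrow> 0"
  by (rule filterlim_compose[OF ln_x_over_x_tendsto_0 filterlim_real_sequentially])

text \<open>The bound on \<open>ln r\<close> is the entropy of p, which is the exponential rate of
  \<open>N choose l N\<close> when l N / N tends to p.\<close>

lemma binomial_lower_growth:
  fixes l :: "nat \<Rightarrow> nat"
  assumes p: "0 < p" "p < 1" and lim: "(\<lambda>N. real (l N) / real N) \<longlonglongrightarrow> p"
    and r: "0 < r" "ln r < - p * ln p - (1 - p) * ln (1 - p)"
    and le: "\<And>N. N \<ge> 1 \<Longrightarrow> l N \<le> N"
  shows "\<forall>\<^sub>F N in sequentially. r ^ N \<le> real (N choose l N)"
proof -
  \<comment> \<open>These are (l + 1)/N and (N - l + 1)/N, matching the \<open>n + 1\<close> in the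
    upper bound for the factorial. They sum to 1 + 2/N, and the excess 2/N produces the correction
    term with \<open>ln (real N)\<close>.\<close>
  let ?a = "\<lambda>N. real (l N) / real N + inverse (real N)"
  let ?b = "\<lambda>N. 1 - real (l N) / real N + inverse (real N)"
  have a: "?a \<longlonglongrightarrow> p + 0" by (intro tendsto_add lim lim_inverse_n)
  have b: "?b \<longlonglongrightarrow> 1 - p + 0" by (intro tendsto_add tendsto_diff tendsto_const lim lim_inverse_n)
  have "(\<lambda>N. - ?a N * ln (?a N) - ?b N * ln (?b N) - 2 * (ln (real N) / real N))
      \<longlonglongrightarrow> - (p + 0) * ln (p + 0) - (1 - p + 0) * ln (1 - p + 0) - 2 * 0"
    using p by (intro tendsto_diff tendsto_mult tendsto_minus tendsto_ln a b lim_ln_over_n tendsto_const) auto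
  then have "\<forall>\<^sub>F N in sequentially. ln r < - ?a N * ln (?a N) - ?b N * ln (?b N) - 2 * (ln (real N) / real N)"
    by (rule order_tendstoD(1)) (use r in simp)
  with eventually_ge_at_top[of 1] show ?thesis
  proof eventually_elim
    case (elim N)
    let ?l = "l N"
    have N0: "real N > 0" and lN: "?l \<le> N" using elim le by auto
    have a_eq: "?a N = (real ?l + 1) / real N" using N0 by (simp add: field_simps)
    have b_eq: "?b N = (real N - real ?l + 1) / real N" using N0 by (simp add: field_simps)
    have lna: "ln (?a N) = ln (real ?l + 1) - ln (real N)" unfolding a_eq using N0 by (simp add: ln_div)
    have lnb: "ln (?b N) = ln (real N - real ?l + 1) - ln (real N)" unfolding b_eq using N0 lN by (simp add: ln_div)
    have "real N * ln r \<le> real N * (- ?a N * ln (?a N) - ?b N * ln (?b N) - 2 * (ln (real N) / real N))"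
      using elim N0 by (intro mult_left_mono) auto
    also have "\<dots> = real N * ln (real N) - (real ?l + 1) * ln (real ?l + 1)
        - (real N - real ?l + 1) * ln (real N - real ?l + 1)"
    proof -
      have "n * (- (x / n) * (A - s) - (y / n) * (B - s) - 2 * (s / n)) = (x + y - 2) * s - x * A - y * B"
        if "n > 0" for n x y A B s :: real using that by (simp add: field_simps)
      from this[OF N0, of "real ?l + 1" "ln (real ?l + 1)" "ln (real N)" "real N - real ?l + 1"
          "ln (real N - real ?l + 1)"]
      show ?thesis unfolding lna lnb unfolding a_eq b_eq by simp
    qed
    also have "\<dots> \<le> ln (fact N) - ln (fact ?l) - ln (fact (N - ?l))"
      using ln_fact_bounds(1)[of N] ln_fact_bounds(2)[of ?l] ln_fact_bounds(2)[of "N - ?l"] lN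
      by (simp add: of_nat_diff)
    also have "\<dots> = ln (real (N choose ?l))"
      using lN by (simp add: binomial_fact ln_div ln_mult)
    finally have "ln (r ^ N) \<le> ln (real (N choose ?l))" using r by (simp add: ln_realpow)
    then show ?case using r lN by (subst (asm) ln_le_cancel_iff) auto
  qed
qed

section \<open>Density of the odd letter and the exponents\<close>

lemma run_append:
  assumes "1 \<le> i" "1 \<le> j" "j \<le> m + w i" "m \<ge> 1"
  shows "\<exists>i' j'. 1 \<le> i' \<and> 1 \<le> j' \<and> j' \<le> m + w i' \<and>
    (\<forall>n'. run m w i j (n + n') = run m w i j n @ run m w i' j' n')"
  using assms
proof (induction n arbitrary: i j)
  case 0
  then show ?case by auto
next
  case (Suc n)
  show ?case
  proof (cases "j < m + w i")
    case True
    then show ?thesis using Suc.IH[of i "j + 1"] Suc.prems by auto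
  next
    case False
    then show ?thesis using Suc.IH[of "i + 1" 1] Suc.prems by auto
  qed
qed

lemma max_b_attained:
  assumes "m \<ge> 1"
  shows "\<exists>i j. 1 \<le> i \<and> 1 \<le> j \<and> j \<le> m + w i \<and> num_b (run m w i j n) = max_b m w n"
proof -
  have "run m w 1 1 n \<in> runs m w n" unfolding runs_def using assms by force
  then have "max_b m w n \<in> num_b ` runs m w n"
    unfolding max_b_def by (intro Max_in) (auto intro: finite_runs)
  then obtain q where "q \<in> runs m w n" "num_b q = max_b m w n" by auto
  then show ?thesis unfolding runs_def by blast
qed

text \<open>An extremal pattern of length a + b, cut after a letters, consists of two
  patterns.\<close>

lemma max_b_add:
  assumes "m \<ge> 1"
  shows "max_b m w (a + b) \<le> max_b m w a + max_b m w b"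
proof -
  obtain i j where ij: "1 \<le> i" "1 \<le> j" "j \<le> m + w i" "num_b (run m w i j (a + b)) = max_b m w (a + b)"
    using max_b_attained[OF assms] by blast
  obtain i' j' where ij': "1 \<le> i'" "1 \<le> j'" "j' \<le> m + w i'"
    "run m w i j (a + b) = run m w i j a @ run m w i' j' b"
    using run_append[where i=i and j=j and w=w, OF ij(1-3) assms] by blast
  have "num_b (run m w i j a) \<le> max_b m w a" "num_b (run m w i' j' b) \<le> max_b m w b"
    by (rule num_b_le_max_b, use ij ij' in \<open>auto simp: runs_def\<close>)+
  then show ?thesis using ij ij' by simp
qed

text \<open>Blocks have length at least 2, so no two b's are adjacent; the extra 1 occurs only when
  the first letter is b.\<close>

lemma num_b_run_le:
  assumes "m \<ge> 2" "j \<le> m + w i"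
  shows "2 * num_b (run m w i j n) \<le> n + (if j = m + w i then 1 else 0)"
  using assms(2)
proof (induction n arbitrary: i j)
  case (Suc n)
  show ?case
  proof (cases "j < m + w i")
    case True
    then show ?thesis using Suc.IH[of "j + 1" i] by (simp split: if_splits)
  next
    case False
    then show ?thesis using Suc.IH[of 1 "i + 1"] Suc.prems assms(1) by (simp split: if_splits)
  qed
qed simp

text \<open>Blocks have length at most m + 1, and \<open>m + w i - j\<close> is the number of a's
  before the first b.\<close>

lemma num_b_run_ge:
  assumes "\<And>i. i \<ge> 1 \<Longrightarrow> w i \<le> 1" "1 \<le> i" "j \<le> m + w i" "m \<ge> 1"
  shows "n \<le> (m + 1) * num_b (run m w i j n) + (m + w i - j)"
  using assms(2,3)
proof (induction n arbitrary: i j)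
  case (Suc n)
  show ?case
  proof (cases "j < m + w i")
    case True
    then show ?thesis using Suc.IH[of i "j + 1"] Suc.prems by simp
  next
    case False
    have "w (i + 1) \<le> 1" using assms(1) by simp
    then show ?thesis using False Suc.IH[of "i + 1" 1] Suc.prems assms(4) by simp
  qed
qed simp

lemma max_b_bounds:
  assumes "m \<ge> 2" "\<And>i. i \<ge> 1 \<Longrightarrow> w i \<le> 1"
  shows "2 * max_b m w n \<le> n + 1" "n \<le> (m + 1) * max_b m w n + m"
proof -
  obtain i j where ij: "1 \<le> i" "1 \<le> j" "j \<le> m + w i" "num_b (run m w i j n) = max_b m w n"
    using max_b_attained[of m] assms(1) by force
  then show "2 * max_b m w n \<le> n + 1" using num_b_run_le[of m j w i n] assms(1) by (simp split: if_splits)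
  have "w i \<le> 1" using assms(2) ij(1) by blast
  then have "m + w i - j \<le> m" using ij(2) by simp
  moreover have "n \<le> (m + 1) * num_b (run m w i j n) + (m + w i - j)"
    by (rule num_b_run_ge) (use assms ij in auto)
  ultimately show "n \<le> (m + 1) * max_b m w n + m" unfolding ij(4) by linarith
qed

lemma max_b_density:
  assumes m: "m \<ge> 2" and w: "\<And>i. i \<ge> 1 \<Longrightarrow> w i \<le> 1"
  shows "\<exists>p. 0 < p \<and> p \<le> 1 / 2 \<and> (\<lambda>n. real (max_b m w n) / real n) \<longlonglongrightarrow> p"
proof -
  have "convergent (\<lambda>n. real (max_b m w n) / real n)"
    by (rule fekete) (use m max_b_add in simp)
  then obtain p where p: "(\<lambda>n. real (max_b m w n) / real n) \<longlonglongrightarrow> p" by (auto simp: convergent_def)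
  \<comment> \<open>The factor 2 absorbs the additive m of the lower bound as soon as n \<ge> 2 m;
    any positive bound suffices.\<close>
  have "1 / (2 * (real m + 1)) \<le> p"
  proof (rule LIMSEQ_le_const[OF p], intro exI[of _ "2 * m"] allI impI)
    fix n assume n: "2 * m \<le> n"
    have "real n \<le> (real m + 1) * real (max_b m w n) + real m"
      using max_b_bounds(2)[where w=w and n=n, OF m w] by (metis of_nat_1 of_nat_add of_nat_le_iff of_nat_mult)
    moreover have "2 * real m \<le> real n" using n by (metis of_nat_le_iff of_nat_mult of_nat_numeral)
    ultimately have "real n \<le> 2 * ((real m + 1) * real (max_b m w n))" by linarith
    then have "real n \<le> 2 * (real m + 1) * real (max_b m w n)" by (simp only: mult.assoc)
    moreover have "real n > 0" using n m by simp
    ultimately show "1 / (2 * (real m + 1)) \<le> real (max_b m w n) / real n"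
      by (simp add: field_simps)
  qed
  moreover have "0 < 1 / (2 * (real m + 1))" by simp
  moreover have "p \<le> 1 / 2"
  proof (rule LIMSEQ_le[OF p])
    have "(\<lambda>n. 1 / 2 + inverse (real n)) \<longlonglongrightarrow> 1 / 2 + 0" by (intro tendsto_intros lim_inverse_n)
    then show "(\<lambda>n. 1 / 2 + inverse (real n)) \<longlonglongrightarrow> 1 / 2" by simp
    have "real (max_b m w n) / real n \<le> 1 / 2 + inverse (real n)" if "n \<ge> 1" for n
    proof -
      have "2 * real (max_b m w n) \<le> real n + 1"
        using max_b_bounds(1)[where w=w and n=n, OF m w] by linarith
      then show ?thesis using that by (simp add: field_simps)
    qed
    then show "\<exists>N. \<forall>n\<ge>N. real (max_b m w n) / real n \<le> 1 / 2 + inverse (real n)" by blast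
  qed
  ultimately show ?thesis using p by (intro exI[of _ p]) linarith
qed

section \<open>The number of patterns\<close>

lemma run_cong:
  "(\<And>t. t \<le> n \<Longrightarrow> w (i + t) = w' (i' + t)) \<Longrightarrow> run m w i j n = run m w' i' j n"
proof (induction n arbitrary: i i' j)
  case (Suc n)
  have "w i = w' i'" using Suc.prems[of 0] by simp
  moreover have "run m w i (j + 1) n = run m w' i' (j + 1) n"
    by (rule Suc.IH) (use Suc.prems in simp)
  moreover have "run m w (i + 1) 1 n = run m w' (i' + 1) 1 n"
    by (rule Suc.IH) (use Suc.prems[of "Suc _"] in simp)
  ultimately show ?case by simp
qed simp

text \<open>A pattern of n letters is determined by its starting position in the first block and by
  the lengths of n + 1 consecutive blocks, that is, by a factor of w.\<close>

lemma card_runs_le: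
  assumes w: "\<And>i. i \<ge> 1 \<Longrightarrow> w i \<le> 1" and fin: "finite (factors w (n + 1))"
  shows "card (runs m w n) \<le> (m + 1) * card (factors w (n + 1))"
proof -
  let ?g = "\<lambda>(j, f). run m (\<lambda>t. f ! t) 0 j n"
  have "runs m w n \<subseteq> ?g ` ({1..m+1} \<times> factors w (n + 1))"
  proof
    fix q assume "q \<in> runs m w n"
    then obtain i j where ij: "1 \<le> i" "1 \<le> j" "j \<le> m + w i" "q = run m w i j n" by (auto simp: runs_def)
    let ?f = "map (\<lambda>t. w (i + t)) [0..<n + 1]"
    have "q = run m (\<lambda>t. ?f ! t) 0 j n" unfolding ij(4)
      by (rule run_cong) (simp add: nth_append)
    moreover have "j \<in> {1..m+1}" using ij w[OF ij(1)] by simp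
    moreover have "?f \<in> factors w (n + 1)" unfolding factors_def using ij(1) by blast
    ultimately show "q \<in> ?g ` ({1..m+1} \<times> factors w (n + 1))" by (intro image_eqI[of _ _ "(j, ?f)"]) auto
  qed
  then have "card (runs m w n) \<le> card ({1..m+1} \<times> factors w (n + 1))"
    using fin by (intro surj_card_le) auto
  then show ?thesis by (simp add: card_cartesian_product)
qed

text \<open>A Sturmian word has n + 1 factors of length n; a word of period p has at most p, since
  each of them already starts within the first period. \<open>C + n\<close> covers both.\<close>

lemma factors_bound:
  assumes "sturmian w \<or> periodic_word w"
  shows "\<exists>C. \<forall>n\<ge>1. finite (factors w n) \<and> card (factors w n) \<le> C + n"
  using assms
proof
  assume "sturmian w"
  then show ?thesis by (intro exI[of _ 1]) (simp add: sturmian_def)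
next
  assume "periodic_word w"
  then obtain p where p: "p > 0" "\<And>i. i \<ge> 1 \<Longrightarrow> w (i + p) = w i" by (auto simp: periodic_word_def)
  have "factors w n \<subseteq> (\<lambda>i. map (\<lambda>j. w (i + j)) [0..<n]) ` {1..p}" for n
  proof -
    have "\<exists>i'\<in>{1..p}. \<forall>j. w (i + j) = w (i' + j)" if "i \<ge> 1" for i
      using that
    proof (induction i rule: less_induct)
      case (less i)
      show ?case
      proof (cases "i \<le> p")
        case True
        then show ?thesis using less.prems by auto
      next
        case False
        then have "i - p < i" "1 \<le> i - p" using p(1) by auto
        then obtain i' where i': "i' \<in> {1..p}" "\<forall>j. w (i - p + j) = w (i' + j)"
          using less.IH by blast
        have "w (i + j) = w (i - p + j)" for j
          using p(2)[of "i - p + j"] False by simp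
        then show ?thesis using i' by auto
      qed
    qed
    then show ?thesis unfolding factors_def by fastforce
  qed
  then have "finite (factors w n) \<and> card (factors w n) \<le> p" for n
    using surj_card_le[OF finite_atLeastAtMost[of 1 p]] finite_surj[OF finite_atLeastAtMost[of 1 p]]
    by (metis card_atLeastAtMost diff_Suc_1)
  then show ?thesis by (meson trans_le_add1)
qed

section \<open>Bounds for the graded codimensions of A and A^#\<close>

definition codim_bound :: "nat \<Rightarrow> (nat \<Rightarrow> nat) \<Rightarrow> nat \<Rightarrow> nat" where
  "codim_bound m w N = (\<Sum>k\<le>N. (N choose k) * codim_kl_bound m w k (N - k))"

lemma gr_codim_A_le:
  assumes "m \<ge> 1"
  shows "gr_codim TYPE('f::field) (A_basis m w) (A_mul m w) A_even n \<le> codim_bound m w n"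
  unfolding gr_codim_def codim_bound_def by (intro sum_mono mult_left_mono gr_codim_kl_A_le assms) simp

text \<open>Choosing the even variables and then the units among them amounts to choosing the units
  first and the even variables among the rest. This turns the double sum into the binomial transform
  of the bound for A.\<close>

lemma gr_codim_U_le:
  assumes "m \<ge> 1"
  shows "gr_codim TYPE('f::field) (U_basis (A_basis m w)) (U_mul (A_mul m w)) (U_even A_even) n
    \<le> (\<Sum>j\<le>n. (n choose j) * codim_bound m w (n - j))"
proof -
  have "gr_codim TYPE('f::field) (U_basis (A_basis m w)) (U_mul (A_mul m w)) (U_even A_even) n
    \<le> (\<Sum>k\<le>n. (n choose k) * (\<Sum>j\<le>k. (k choose j) * codim_kl_bound m w (k - j) (n - k)))"
    unfolding gr_codim_def by (intro sum_mono mult_left_mono gr_codim_kl_U_le assms) simp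
  also have "\<dots> = (\<Sum>(k, j)\<in>Sigma {..n} (\<lambda>k. {..k}). (n choose k) * (k choose j) * codim_kl_bound m w (k - j) (n - k))"
    by (simp add: sum_distrib_left sum.Sigma mult.assoc)
  also have "\<dots> = (\<Sum>(j, k)\<in>Sigma {..n} (\<lambda>j. {..n - j}). (n choose j) * ((n - j choose k) * codim_kl_bound m w k (n - j - k)))"
    by (rule sum.reindex_bij_witness[of _ "\<lambda>(j, k). (k + j, j)" "\<lambda>(k, j). (j, k - j)"])
      (auto simp: choose_mult)
  also have "\<dots> = (\<Sum>j\<le>n. (n choose j) * codim_bound m w (n - j))"
    by (simp add: codim_bound_def sum_distrib_left sum.Sigma)
  finally show ?thesis .
qed

text \<open>A Chernoff-type weighting: for l \<le> K and x \<le> 1 one has 1 \<le> x^l / x^K, so the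
  binomials with l \<le> K sum to at most (1 + x)^N / x^K. Here K is
  \<open>max_b m w (N - 1) + 1\<close>.\<close>

lemma codim_bound_le:
  assumes x: "0 < x" "x \<le> 1"
  shows "real (codim_bound m w N) \<le> real ((N + 1) * (card (runs m w (N - 1)) + 1)) * ((1 + x) ^ N * (1 / x) ^ (max_b m w (N - 1) + 1))"
proof (cases "N = 0")
  case True
  have "1 \<le> (1 / x) ^ (max_b m w (N - 1) + 1)" using x by (intro one_le_power) simp
  moreover have "1 \<le> real ((N + 1) * (card (runs m w (N - 1)) + 1))" by simp
  ultimately have "1 * 1 \<le> real ((N + 1) * (card (runs m w (N - 1)) + 1)) * (1 / x) ^ (max_b m w (N - 1) + 1)"
    by (intro mult_mono) auto
  then show ?thesis using True by (simp add: codim_bound_def codim_kl_bound_def)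
next
  case False
  let ?K = "max_b m w (N - 1) + 1" and ?R = "card (runs m w (N - 1))"
  have t: "real (codim_kl_bound m w k (N - k)) \<le> real (N * ?R) * ((1 / x) ^ ?K * x ^ (N - k))" if k: "k \<le> N" for k
  proof (cases "N - k \<le> ?K")
    case True
    have "(1 / x) ^ ?K * x ^ (N - k) = (1 / x) ^ (?K - (N - k))"
      using True x by (simp add: power_diff power_one_over field_simps)
    also have "\<dots> \<ge> 1" using x by (intro one_le_power) simp
    finally have "real (N * ?R) * 1 \<le> real (N * ?R) * ((1 / x) ^ ?K * x ^ (N - k))"
      by (intro mult_left_mono) auto
    moreover have "codim_kl_bound m w k (N - k) \<le> N * ?R" using k False by (simp add: codim_kl_bound_def)
    ultimately show ?thesis by (smt (verit) of_nat_le_iff)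
  next
    case False
    then have "codim_kl_bound m w k (N - k) = 0" using k \<open>N \<noteq> 0\<close> by (simp add: codim_kl_bound_def)
    then show ?thesis using x by simp
  qed
  have "real (codim_bound m w N) \<le> (\<Sum>k\<le>N. real (N choose k) * (real (N * ?R) * ((1 / x) ^ ?K * x ^ (N - k))))"
    unfolding codim_bound_def of_nat_sum of_nat_mult[of "N choose _"] by (intro sum_mono mult_left_mono t) auto
  also have "\<dots> = real (N * ?R) * (1 / x) ^ ?K * (\<Sum>k\<le>N. real (N choose k) * 1 ^ k * x ^ (N - k))"
  proof -
    have "(\<Sum>k\<le>N. real (N choose k) * (R * (y * x ^ (N - k)))) = R * y * (\<Sum>k\<le>N. real (N choose k) * 1 ^ k * x ^ (N - k))"
      for R y :: real by (simp add: sum_distrib_left mult_ac)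
    then show ?thesis .
  qed
  also have "\<dots> = real (N * ?R) * (1 / x) ^ ?K * (1 + x) ^ N"
    by (simp only: binomial_ring)
  also have "\<dots> = real (N * ?R) * ((1 + x) ^ N * (1 / x) ^ ?K)" by simp
  also have "\<dots> \<le> real ((N + 1) * (?R + 1)) * ((1 + x) ^ N * (1 / x) ^ ?K)"
    using x by (intro mult_right_mono) auto
  finally show ?thesis .
qed

text \<open>An extremal pattern of N - 1 letters is preceded by one first variable. The parity of
  the block in which the pattern starts decides whether that variable is odd, so l is known only up
  to 1.\<close>

lemma gr_codim_lower:
  assumes m: "m \<ge> 1" and N: "N \<ge> 1"
  shows "\<exists>l. max_b m w (N - 1) \<le> l \<and> l \<le> max_b m w (N - 1) + 1 \<and> l \<le> N \<and>
    N choose l \<le> gr_codim TYPE('f::field) (A_basis m w) (A_mul m w) A_even N \<and>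
    (2 \<le> l \<longrightarrow> (\<forall>n\<ge>N. (n choose N) * (N choose l)
      \<le> gr_codim TYPE('f) (U_basis (A_basis m w)) (U_mul (A_mul m w)) (U_even A_even) n))"
proof -
  obtain i j where ij: "1 \<le> i" "1 \<le> j" "j \<le> m + w i" "num_b (run m w i j (N - 1)) = max_b m w (N - 1)"
    using max_b_attained[OF m] by blast
  define q where "q = run m w i j (N - 1)"
  define l where "l = odds i q"
  have nbq: "num_b q \<le> N - 1" using length_filter_id(2)[of q] by (simp add: q_def)
  then have "num_b q + 1 \<le> N" using N by linarith
  then have lN: "l \<le> N" by (simp add: l_def odds_def)
  define k where "k = N - l"
  have kl: "k + l = N - 1 + 1" using lN N by (simp add: k_def)
  have kN: "k \<le> N" "N - k = l" using lN by (auto simp: k_def)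
  let ?cA = "gr_codim_kl TYPE('f::field) (A_basis m w) (A_mul m w) A_even"
  let ?cU = "gr_codim_kl TYPE('f::field) (U_basis (A_basis m w)) (U_mul (A_mul m w)) (U_even A_even)"
  have "1 \<le> ?cA k l" by (rule gr_codim_kl_A_ge[where i=i and j=j and w=w, OF m ij(1-3) q_def l_def kl])
  then have "(N choose k) * 1 \<le> (N choose k) * ?cA k (N - k)" unfolding kN(2) by (intro mult_left_mono) auto
  also have "\<dots> \<le> gr_codim TYPE('f::field) (A_basis m w) (A_mul m w) A_even N"
    unfolding gr_codim_def using kN by (intro member_le_sum[of k "{..N}"]) auto
  finally have A: "N choose l \<le> gr_codim TYPE('f::field) (A_basis m w) (A_mul m w) A_even N"
    using lN by (simp add: k_def binomial_symmetric[of l N])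
  have U: "(n choose N) * (N choose l)
      \<le> gr_codim TYPE('f) (U_basis (A_basis m w)) (U_mul (A_mul m w)) (U_even A_even) n"
    if l2: "2 \<le> l" and n: "n \<ge> N" for n
  proof -
    define s where "s = n - N"
    have ks: "k + s \<le> n" "n - (k + s) = l" "s \<le> n" "n - s = N" using n lN by (auto simp: k_def s_def)
    \<comment> \<open>Both products count the ways to split n variables into s units, k other even
      variables and l odd ones.\<close>
    have "(n choose N) * (N choose l) = (n choose s) * (N choose k)"
      using n lN by (simp add: s_def k_def binomial_symmetric[of l N] binomial_symmetric[of N n])
    also have "\<dots> = (n choose (k + s)) * ((k + s) choose s)"
      using choose_mult[of s "k + s" n] ks by simp
    also have "\<dots> \<le> (n choose (k + s)) * ?cU (k + s) (n - (k + s))"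
      unfolding ks(2) by (intro mult_left_mono gr_codim_kl_U_ge[where i=i and j=j and w=w, OF m ij(1-3) q_def l_def kl l2]) simp
    also have "\<dots> \<le> gr_codim TYPE('f) (U_basis (A_basis m w)) (U_mul (A_mul m w)) (U_even A_even) n"
      unfolding gr_codim_def using ks by (intro member_le_sum[of "k + s" "{..n}"]) auto
    finally show ?thesis .
  qed
  have "max_b m w (N - 1) \<le> l" "l \<le> max_b m w (N - 1) + 1" using ij(4) by (auto simp: l_def odds_def q_def)
  then show ?thesis using A U lN by blast
qed

section \<open>Exponential rate of the upper bound and conclusion\<close>

lemma upper_growth:
  fixes K :: "nat \<Rightarrow> nat"
  assumes x: "0 < x" "x \<le> 1" and lim: "(\<lambda>N. real (K N) / real N) \<longlonglongrightarrow> p"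
    and r: "0 < r" "ln (1 + x) - p * ln x < ln r" and c: "c > 0" "d > 0"
  shows "\<forall>\<^sub>F N in sequentially. (real N + 1) * (c * (real N + d)) * ((1 + x) ^ N * (1 / x) ^ K N) \<le> r ^ N"
proof -
  have lnd: "(\<lambda>N. ln (real N + e) / real N) \<longlonglongrightarrow> 0" if "e > 0" for e :: real
  proof -
    have "(\<lambda>N. ln (real N) / real N + ln (1 + e * inverse (real N)) * inverse (real N)) \<longlonglongrightarrow> 0 + ln (1 + e * 0) * 0"
      by (intro tendsto_intros lim_ln_over_n lim_inverse_n) simp
    moreover have "\<forall>\<^sub>F N in sequentially. ln (real N) / real N + ln (1 + e * inverse (real N)) * inverse (real N) = ln (real N + e) / real N"
      using eventually_gt_at_top[of 0]
    proof eventually_elim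
      case (elim N)
      have "1 + e * inverse (real N) > 0" using elim that by (simp add: add_pos_pos)
      moreover have "real N + e = real N * (1 + e * inverse (real N))" using elim by (simp add: field_simps)
      ultimately have "ln (real N + e) = ln (real N) + ln (1 + e * inverse (real N))"
        using elim by (simp only: ln_mult_pos of_nat_0_less_iff)
      then show ?case by (simp add: add_divide_distrib divide_inverse distrib_right)
    qed
    ultimately show ?thesis by (simp add: Lim_transform_eventually)
  qed
  have "(\<lambda>N. ln (real N + 1) / real N + (ln c * inverse (real N) + ln (real N + d) / real N) + (ln (1 + x) - real (K N) / real N * ln x))
      \<longlonglongrightarrow> 0 + (ln c * 0 + 0) + (ln (1 + x) - p * ln x)"
    by (intro tendsto_intros lnd lim lim_inverse_n c) simp
  then have "\<forall>\<^sub>F N in sequentially. ln (real N + 1) / real N + (ln c * inverse (real N) + ln (real N + d) / real N) + (ln (1 + x) - real (K N) / real N * ln x) < ln r"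
    by (rule order_tendstoD(2)) (use r in simp)
  with eventually_gt_at_top[of 0] show ?thesis
  proof eventually_elim
    case (elim N)
    let ?V = "(real N + 1) * (c * (real N + d)) * ((1 + x) ^ N * (1 / x) ^ K N)"
    have Vpos: "?V > 0" using c x by (intro mult_pos_pos) (auto intro: add_nonneg_pos)
    have nz: "real N + d \<noteq> 0" using c by (simp add: add_nonneg_pos less_imp_neq[symmetric])
    have "ln ?V = ln (real N + 1) + (ln c + ln (real N + d)) + (real N * ln (1 + x) - real (K N) * ln x)"
      using c x nz by (simp add: ln_mult ln_realpow ln_div)
    also have "\<dots> = real N * (ln (real N + 1) / real N + (ln c * inverse (real N) + ln (real N + d) / real N) + (ln (1 + x) - real (K N) / real N * ln x))"
      using elim by (simp add: field_simps)
    also have "\<dots> \<le> real N * ln r" using elim by (intro mult_left_mono) auto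
    also have "\<dots> = ln (r ^ N)" using r by (simp add: ln_realpow)
    finally show ?case using Vpos r by (subst (asm) ln_le_cancel_iff) auto
  qed
qed

lemma lim_shifted:
  fixes K :: "nat \<Rightarrow> nat"
  assumes "(\<lambda>n. real (K n) / real n) \<longlonglongrightarrow> p"
  shows "(\<lambda>N. real (K (N - 1)) / real N) \<longlonglongrightarrow> p"
proof -
  have "(\<lambda>n. real (K n) / real n * (real n / real (Suc n))) \<longlonglongrightarrow> p * 1"
    by (intro tendsto_mult assms LIMSEQ_n_over_Suc_n)
  moreover have "\<forall>\<^sub>F n in sequentially. real (K n) / real n * (real n / real (Suc n)) = real (K n) / real (Suc n)"
    using eventually_gt_at_top[of 0] by eventually_elim simp
  ultimately have "(\<lambda>n. real (K n) / real (Suc n)) \<longlonglongrightarrow> p" by (simp add: Lim_transform_eventually)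
  then show ?thesis by (subst filterlim_sequentially_Suc[symmetric]) simp
qed

theorem theorem4:
  fixes m :: nat and w :: "nat \<Rightarrow> nat"
  assumes "m \<ge> 2"
    and "binary_word w"
    and "sturmian w \<or> periodic_word w"
  shows "\<exists>L. has_gr_exp TYPE('f::field_char_0) (A_basis m w) (A_mul m w) A_even L
           \<and> has_gr_exp TYPE('f) (U_basis (A_basis m w)) (U_mul (A_mul m w)) (U_even A_even) (1 + L)"
proof -
  have m1: "m \<ge> 1" using assms(1) by simp
  have w: "w i \<le> 1" if "i \<ge> 1" for i using assms(2) that by (force simp: binary_word_def)
  obtain p where p: "0 < p" "p \<le> 1 / 2" "(\<lambda>n. real (max_b m w n) / real n) \<longlonglongrightarrow> p"
    using max_b_density[where w=w, OF assms(1) w] by blast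
  obtain C where C: "\<And>n. n \<ge> 1 \<Longrightarrow> finite (factors w n) \<and> card (factors w n) \<le> C + n"
    using factors_bound[OF assms(3)] by blast
  \<comment> \<open>This x minimises ln (1 + x) - p ln x, and the minimum h is the entropy of p; so
    the weighted upper bound and the single binomial below have the same rate. From p \<le> 1/2
    comes x \<le> 1, as the weighting requires.\<close>
  define x where "x = p / (1 - p)"
  have x: "0 < x" "x \<le> 1" using p by (auto simp: x_def field_simps)
  define h where "h = ln (1 + x) - p * ln x"
  have h: "h = - p * ln p - (1 - p) * ln (1 - p)"
  proof -
    have "1 + x = 1 / (1 - p)" using p by (simp add: x_def field_simps)
    then have "ln (1 + x) = - ln (1 - p)" using p by (simp add: ln_div)
    moreover have "ln x = ln p - ln (1 - p)" using p by (simp add: x_def ln_div)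
    ultimately show ?thesis unfolding h_def by (simp only:) (simp add: algebra_simps)
  qed
  let ?K = "\<lambda>N. max_b m w (N - 1)"
  have limK: "(\<lambda>N. real (?K N) / real N) \<longlonglongrightarrow> p" by (rule lim_shifted[OF p(3)])
  have limK1: "(\<lambda>N. real (?K N + 1) / real N) \<longlonglongrightarrow> p"
    using tendsto_add[OF limK lim_inverse_n] by (simp add: add_divide_distrib inverse_eq_divide add.commute)
  \<comment> \<open>The middle factor comes from the count of patterns, at most (m + 1)(N + C + 1)
    for every N including 0; \<open>C + 2\<close> also absorbs the added 1.\<close>
  define V where "V N = (real N + 1) * (real (m + 1) * (real N + real (C + 2))) * ((1 + x) ^ N * (1 / x) ^ (?K N + 1))" for N
  let ?cA = "gr_codim TYPE('f) (A_basis m w) (A_mul m w) A_even"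
  let ?cU = "gr_codim TYPE('f) (U_basis (A_basis m w)) (U_mul (A_mul m w)) (U_even A_even)"
  have UV: "real (codim_bound m w N) \<le> V N" for N
  proof -
    have f: "finite (factors w (N - 1 + 1))" "card (factors w (N - 1 + 1)) \<le> C + (N - 1 + 1)"
      using C[of "N - 1 + 1"] by auto
    have "card (runs m w (N - 1)) \<le> (m + 1) * card (factors w (N - 1 + 1))" by (rule card_runs_le[where w=w, OF w f(1)])
    also have "\<dots> \<le> (m + 1) * (C + (N - 1 + 1))" by (intro mult_left_mono f(2)) simp
    also have "\<dots> \<le> (m + 1) * (N + C + 1)" by (intro mult_left_mono) auto
    finally have "card (runs m w (N - 1)) + 1 \<le> (m + 1) * (N + (C + 2))" by simp
    then have "(N + 1) * (card (runs m w (N - 1)) + 1) \<le> (N + 1) * ((m + 1) * (N + (C + 2)))"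
      by (intro mult_left_mono) auto
    then have "real ((N + 1) * (card (runs m w (N - 1)) + 1)) \<le> real ((N + 1) * ((m + 1) * (N + (C + 2))))"
      by (simp only: of_nat_le_iff)
    also have "\<dots> = (real N + 1) * (real (m + 1) * (real N + real (C + 2)))" by (simp add: algebra_simps)
    finally have "real ((N + 1) * (card (runs m w (N - 1)) + 1)) * ((1 + x) ^ N * (1 / x) ^ (?K N + 1)) \<le> V N"
      unfolding V_def using x by (intro mult_right_mono) auto
    then show ?thesis using codim_bound_le[OF x, of m w N] by linarith
  qed
  have "\<forall>N. \<exists>l. N \<ge> 1 \<longrightarrow> ?K N \<le> l \<and> l \<le> ?K N + 1 \<and> l \<le> N \<and> N choose l \<le> ?cA N \<and>
      (2 \<le> l \<longrightarrow> (\<forall>n\<ge>N. (n choose N) * (N choose l) \<le> ?cU n))"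
    using gr_codim_lower[OF m1] by blast
  then obtain l where l: "\<And>N. N \<ge> 1 \<Longrightarrow> ?K N \<le> l N \<and> l N \<le> ?K N + 1 \<and> l N \<le> N \<and> N choose l N \<le> ?cA N \<and>
      (2 \<le> l N \<longrightarrow> (\<forall>n\<ge>N. (n choose N) * (N choose l N) \<le> ?cU n))"
    unfolding choice_iff by blast
  have liml: "(\<lambda>N. real (l N) / real N) \<longlonglongrightarrow> p"
  proof (rule tendsto_sandwich[OF _ _ limK limK1])
    show "\<forall>\<^sub>F N in sequentially. real (?K N) / real N \<le> real (l N) / real N"
      by (rule eventually_sequentiallyI[of 1]) (use l in \<open>simp add: divide_right_mono\<close>)
    show "\<forall>\<^sub>F N in sequentially. real (l N) / real N \<le> real (?K N + 1) / real N"
    proof (rule eventually_sequentiallyI[of 1])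
      fix N :: nat assume "1 \<le> N"
      then have "real (l N) \<le> real (?K N + 1)" using l by (simp only: of_nat_le_iff)
      then show "real (l N) / real N \<le> real (?K N + 1) / real N" by (rule divide_right_mono) simp
    qed
  qed
  \<comment> \<open>If l N < 2, the extremal pattern has at most one b, so N - 1 \<le> 2 m + 1,
    which fails from 3 m + 3 on.\<close>
  have l2: "2 \<le> l N" if "3 * m + 3 \<le> N" for N
  proof (rule ccontr)
    assume "\<not> 2 \<le> l N"
    then have "?K N \<le> 1" using l[of N] that by simp
    then have "(m + 1) * ?K N \<le> m + 1" by (metis mult.right_neutral mult_le_mono2)
    then show False using max_b_bounds(2)[where w=w and n="N - 1", OF assms(1) w] that by simp
  qed
  have up: "\<forall>\<^sub>F N in sequentially. V N \<le> r ^ N" if r: "exp h < r" for r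
  proof -
    have r0: "0 < r" using r exp_gt_zero less_trans by blast
    have "h < ln r" using r r0 by (metis exp_less_cancel_iff exp_ln)
    then show ?thesis unfolding V_def
      by (intro upper_growth[OF x limK1 r0]) (simp_all add: h_def)
  qed
  have lo: "\<forall>\<^sub>F N in sequentially. r ^ N \<le> real (N choose l N)" if r: "0 < r" "r < exp h" for r
  proof -
    have "ln r < h" using r by (metis exp_less_cancel_iff exp_ln)
    then show ?thesis using h p l by (intro binomial_lower_growth[OF p(1) _ liml r(1)]) auto
  qed
  have cV: "real (?cA N) \<le> V N" for N
    using gr_codim_A_le[OF m1, of w N, where 'f = 'f] UV[of N] by linarith
  have dc: "\<forall>\<^sub>F N in sequentially. real (N choose l N) \<le> real (?cA N)"
    by (rule eventually_sequentiallyI[of 1]) (use l in simp)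
  have CV: "real (?cU n) \<le> (\<Sum>j\<le>n. real (n choose j) * V (n - j))" for n
  proof -
    have "real (?cU n) \<le> real (\<Sum>j\<le>n. (n choose j) * codim_bound m w (n - j))"
      using gr_codim_U_le[OF m1, of w n, where 'f = 'f] by (simp only: of_nat_le_iff)
    also have "\<dots> = (\<Sum>j\<le>n. real (n choose j) * real (codim_bound m w (n - j)))" by simp
    also have "\<dots> \<le> (\<Sum>j\<le>n. real (n choose j) * V (n - j))" by (intro sum_mono mult_left_mono UV) simp
    finally show ?thesis .
  qed
  have dC: "real (n choose N) * real (N choose l N) \<le> real (?cU n)" if "3 * m + 3 \<le> N" "N \<le> n" for n N
  proof -
    have "(n choose N) * (N choose l N) \<le> ?cU n" using l[of N] l2[OF that(1)] that by simp
    then show ?thesis by (metis of_nat_le_iff of_nat_mult)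
  qed
  have "(\<lambda>n. root n (real (?cA n))) \<longlonglongrightarrow> exp h" "(\<lambda>n. root n (real (?cU n))) \<longlonglongrightarrow> 1 + exp h"
    using roots_binomial_transform[of "exp h" V "\<lambda>N. real (N choose l N)" "\<lambda>N. real (?cA N)" "\<lambda>N. real (?cU N)" "3 * m + 3",
        OF exp_gt_zero up lo of_nat_0_le_iff of_nat_0_le_iff cV dc CV dC] by simp_all
  then show ?thesis unfolding has_gr_exp_def by blast
qed

end
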